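(* Let $V$ be a faithful $k$-dimensional representation of a finite group $H$ over a field $\mathbb{F}$ and let $G\subseteq H$ be a subgroup. Suppose there exist $f_1,f_2,\dots,f_k\in\mathbb{F}(V)^G$ such that $\mathbb{F}(V)^G=\mathbb{F}(f_1,f_2,\dots,f_k)$, and there exists a homogeneous polynomial $f\in\mathbb{F}[f_1,f_2,\dots,f_k]\cap\mathbb{F}[V]^G$ such that $\mathbb{F}[f_1,f_2,\dots,f_k][f^{-1}]\subseteq\mathbb{F}[V]^G[f^{-1}]$. (1) If $\mathbb{F}[V]^G[f^{-1}]$ is integral over $\mathbb{F}[f_1,f_2,\dots,f_k][f^{-1}]$, then $$\mathbb{F}[V]^G[f^{-1}]=\mathbb{F}[f_1,f_2,\dots,f_k][f^{-1}].$$ (2) If $\mathbb{F}[V]^H\subseteq\mathbb{F}[f_1,f_2,\dots,f_k][f^{-1}]$, then $$\mathbb{F}[V]^G[f^{-1}]=\mathbb{F}[f_1,f_2,\dots,f_k][f^{-1}].$$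
   Context: $\mathbb{F}[V]$ is the ring of polynomial functions on $V$ (a polynomial ring in $k$ variables over $\mathbb{F}$, graded by degree), $\mathbb{F}(V)$ is its field of fractions, and superscripts $G$, $H$ denote the subring (subfield) of elements fixed by the group. The $f_i$ are rational functions, and $\mathbb{F}[f_1,\dots,f_k]$ is the $\mathbb{F}$-subalgebra of $\mathbb{F}(V)$ they generate. The element $f$ is nonzero, and all rings obtained by adjoining $f^{-1}$ are regarded as subrings of $\mathbb{F}(V)$. *)

theory Defs
  imports
    "HOL-Library.Poly_Mapping"
    "HOL-Computational_Algebra.Polynomial_Factorial"
    "HOL-Algebra.Group_Action"
    "HOL-Algebra.Generated_Fields"
    "HOL-Algebra.Algebraic_Closure_Type"
begin

section \<open>Polynomials and rational functions\<close>

text \<open>Polynomials in countably many indeterminates, indexed from 0: finitely supported functions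
  from exponent vectors to coefficients. The polynomial ring in k indeterminates and its field of
  fractions are the subrings of those elements that only involve the first k indeterminates.\<close>

type_synonym 'f mvpoly = "(nat \<Rightarrow>\<^sub>0 nat) \<Rightarrow>\<^sub>0 'f"

definition const_poly :: "'f::field \<Rightarrow> 'f mvpoly" where
  "const_poly c = Poly_Mapping.single 0 c"

definition var_poly :: "nat \<Rightarrow> 'f::field mvpoly" where
  "var_poly i = Poly_Mapping.single (Poly_Mapping.single i 1) 1"

definition mvpoly_ring :: "nat \<Rightarrow> 'f::field mvpoly set" where
  "mvpoly_ring k = {p. \<forall>m\<in>Poly_Mapping.keys p. Poly_Mapping.keys m \<subseteq> {..<k}}"

definition rat_field :: "nat \<Rightarrow> 'f::field mvpoly fract set" where
  "rat_field k = {Fraction_Field.Fract p q | p q. p \<in> mvpoly_ring k \<and> q \<in> mvpoly_ring k \<and> q \<noteq> 0}"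

definition homogeneous_poly :: "'f::field mvpoly \<Rightarrow> bool" where
  "homogeneous_poly p \<longleftrightarrow>
     (\<exists>d. \<forall>m\<in>Poly_Mapping.keys p. (\<Sum>i\<in>Poly_Mapping.keys m. Poly_Mapping.lookup m i) = d)"

definition subst_poly :: "(nat \<Rightarrow> 'f::field mvpoly) \<Rightarrow> 'f mvpoly \<Rightarrow> 'f mvpoly" where
  "subst_poly \<sigma> p =
     (\<Sum>m\<in>Poly_Mapping.keys p. const_poly (Poly_Mapping.lookup p m) *
        (\<Prod>i\<in>Poly_Mapping.keys m. \<sigma> i ^ Poly_Mapping.lookup m i))"

section \<open>Subalgebras, localisations, integral extensions\<close>

definition gen_algebra :: "'f::field mvpoly fract set \<Rightarrow> 'f mvpoly fract set" where
  "gen_algebra S =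
     generate_ring ring_of_type_algebra ((\<lambda>c. to_fract (const_poly c)) ` UNIV \<union> S)"

definition gen_field :: "'f::field mvpoly fract set \<Rightarrow> 'f mvpoly fract set" where
  "gen_field S =
     generate_field ring_of_type_algebra ((\<lambda>c. to_fract (const_poly c)) ` UNIV \<union> S)"

definition adjoin_inverse :: "'a::field set \<Rightarrow> 'a \<Rightarrow> 'a set" where
  "adjoin_inverse A f = generate_ring ring_of_type_algebra (A \<union> {inverse f})"

definition integral_over :: "'a::comm_ring_1 set \<Rightarrow> 'a set \<Rightarrow> bool" where
  "integral_over B A \<longleftrightarrow>
     (\<forall>a\<in>A. \<exists>p. lead_coeff p = 1 \<and> (\<forall>i. coeff p i \<in> B) \<and> poly p a = 0)"

section \<open>Representations and their invariants\<close>

text \<open>A faithful linear action of a finite group H on a vector space V (a whole type), with a basis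
  b 0, ..., b (k - 1) of V fixed so as to have coordinates.\<close>

locale faithful_representation =
  vector_space scale + faithful_action H "UNIV :: 'v set" \<rho>
  for scale :: "'f::field \<Rightarrow> 'v::ab_group_add \<Rightarrow> 'v"
    and k :: nat and b :: "nat \<Rightarrow> 'v"
    and H :: "('h, 'm) monoid_scheme" (structure) and \<rho> :: "'h \<Rightarrow> 'v \<Rightarrow> 'v" +
  assumes finite_group: "finite (carrier H)"
    and linear_action: "h \<in> carrier H \<Longrightarrow> Vector_Spaces.linear scale scale (\<rho> h)"
    and basis_inj: "inj_on b {..<k}"
    and basis_independent: "independent (b ` {..<k})"
    and basis_span: "span (b ` {..<k}) = UNIV"

text \<open>The indeterminate with index j is the j-th coordinate function on V with respect to b. For a
  linear map T on V, the composition of that coordinate function with T is the linear form below,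
  so a group element h acts on polynomial functions by sending p to the function taking v to
  p (inv h v).\<close>

definition coord_pullback ::
  "('f::field \<Rightarrow> 'v::ab_group_add \<Rightarrow> 'v) \<Rightarrow> nat \<Rightarrow> (nat \<Rightarrow> 'v) \<Rightarrow> ('v \<Rightarrow> 'v) \<Rightarrow> nat \<Rightarrow> 'f mvpoly" where
  "coord_pullback scale k b T j =
     (\<Sum>i<k. const_poly (module.representation scale (b ` {..<k}) (T (b i)) (b j)) * var_poly i)"

definition poly_action ::
  "('f::field \<Rightarrow> 'v::ab_group_add \<Rightarrow> 'v) \<Rightarrow> nat \<Rightarrow> (nat \<Rightarrow> 'v) \<Rightarrow> ('h, 'm) monoid_scheme \<Rightarrow>
   ('h \<Rightarrow> 'v \<Rightarrow> 'v) \<Rightarrow> 'h \<Rightarrow> 'f mvpoly \<Rightarrow> 'f mvpoly" where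
  "poly_action scale k b H \<rho> h p = subst_poly (coord_pullback scale k b (\<rho> (inv\<^bsub>H\<^esub> h))) p"

text \<open>The induced action on fractions, h (p / q) = (h p) / (h q). It is only meaningful on
  \<^const>\<open>rat_field\<close>; there the result does not depend on the chosen representatives, since h acts on
  \<^const>\<open>mvpoly_ring\<close> by a ring automorphism.\<close>

definition rat_action ::
  "('f::field \<Rightarrow> 'v::ab_group_add \<Rightarrow> 'v) \<Rightarrow> nat \<Rightarrow> (nat \<Rightarrow> 'v) \<Rightarrow> ('h, 'm) monoid_scheme \<Rightarrow>
   ('h \<Rightarrow> 'v \<Rightarrow> 'v) \<Rightarrow> 'h \<Rightarrow> 'f mvpoly fract \<Rightarrow> 'f mvpoly fract" where
  "rat_action scale k b H \<rho> h r =
     (THE s. \<exists>p\<in>mvpoly_ring k. \<exists>q\<in>mvpoly_ring k. q \<noteq> 0 \<and> r = Fraction_Field.Fract p q \<and>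
        s = Fraction_Field.Fract (poly_action scale k b H \<rho> h p) (poly_action scale k b H \<rho> h q))"

definition poly_invariants ::
  "('f::field \<Rightarrow> 'v::ab_group_add \<Rightarrow> 'v) \<Rightarrow> nat \<Rightarrow> (nat \<Rightarrow> 'v) \<Rightarrow> ('h, 'm) monoid_scheme \<Rightarrow>
   ('h \<Rightarrow> 'v \<Rightarrow> 'v) \<Rightarrow> 'h set \<Rightarrow> 'f mvpoly set" where
  "poly_invariants scale k b H \<rho> G =
     {p \<in> mvpoly_ring k. \<forall>g\<in>G. poly_action scale k b H \<rho> g p = p}"

definition rat_invariants ::
  "('f::field \<Rightarrow> 'v::ab_group_add \<Rightarrow> 'v) \<Rightarrow> nat \<Rightarrow> (nat \<Rightarrow> 'v) \<Rightarrow> ('h, 'm) monoid_scheme \<Rightarrow>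
   ('h \<Rightarrow> 'v \<Rightarrow> 'v) \<Rightarrow> 'h set \<Rightarrow> 'f mvpoly fract set" where
  "rat_invariants scale k b H \<rho> G =
     {r \<in> rat_field k. \<forall>g\<in>G. rat_action scale k b H \<rho> g r = r}"

end

theory Submission
  imports Defs
begin

text \<open>Write B for the algebra F[f_1, ..., f_k]. The inclusion of B[1/f] in F[V]^G[1/f] being given, it
  suffices to show that every a in F[V]^G lies in B[1/f]. Such an a lies in F(V)^G, the field generated
  by the f_i, so it is a quotient of two elements of B. It is also integral over B[1/f]: in part (1) by
  assumption, and in part (2) because a is a root of the monic polynomial \<open>\<Prod>h\<in>H. (T - h a)\<close>, whose
  coefficients lie in F[V]^H and hence in B[1/f] (\<open>integral_over_invariants\<close>). So everything follows
  once B[1/f] is known to be integrally closed in its field of fractions.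

  The reason for this is that f_1, ..., f_k are algebraically independent over F. The k coordinate
  functions x_1, ..., x_k are algebraically independent
  (\<open>variables_algebraically_independent\<close>), and each x_i is algebraic over F(V)^G, again by its orbit
  polynomial. Hence the k elements f_i span, in the matroid of algebraic independence, an independent
  set of k elements. By Steinitz exchange none of them is redundant
  (\<open>exchange_closure.spanning_family_independent\<close>, applied to \<open>exchange_closure_algebraic_span\<close>).

  Thus B is a polynomial ring. That it is integrally closed is proved by adjoining one f_i at a
  time, for the stronger property of being completely integrally closed
  (\<open>completely_integrally_closed_adjoin\<close>): over a field, division with remainder and a comparison of
  degrees suffice, and over a general ring one argues with leading coefficients. Integral closedness is
  then transferred to B[1/f] by clearing denominators (\<open>integral_in_localisation\<close>).\<close>

section \<open>Subrings and subfields of a field\<close>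

abbreviation is_subring :: "'a::field set \<Rightarrow> bool" where
  "is_subring R \<equiv> subring R ring_of_type_algebra"

abbreviation is_subfield :: "'a::field set \<Rightarrow> bool" where
  "is_subfield E \<equiv> subfield E ring_of_type_algebra"

lemma ring_of_type_algebra_simps [simp]:
  "carrier (ring_of_type_algebra :: 'a::field ring) = UNIV"
  "x \<otimes>\<^bsub>ring_of_type_algebra\<^esub> y = x * (y :: 'a)"
  "x \<oplus>\<^bsub>ring_of_type_algebra\<^esub> y = x + (y :: 'a)"
  "\<one>\<^bsub>ring_of_type_algebra\<^esub> = (1 :: 'a)"
  "\<zero>\<^bsub>ring_of_type_algebra\<^esub> = (0 :: 'a)"
  by (simp_all add: ring_of_type_algebra_def)

lemma ring_of_type_algebra_uminus [simp]: "\<ominus>\<^bsub>ring_of_type_algebra\<^esub> x = - (x :: 'a::field)"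
proof -
  interpret K: field "ring_of_type_algebra :: 'a ring" by rule
  show ?thesis using K.minus_equality[of "-x" x] by simp
qed

lemma ring_of_type_algebra_inverse [simp]:
  assumes "x \<noteq> 0" shows "inv\<^bsub>ring_of_type_algebra\<^esub> x = inverse (x :: 'a::field)"
proof -
  interpret K: field "ring_of_type_algebra :: 'a ring" by rule
  show ?thesis using K.inv_unique'[of x "inverse x"] assms by simp
qed

lemma ring_of_type_algebra_power [simp]:
  "x [^]\<^bsub>ring_of_type_algebra\<^esub> (n::nat) = (x :: 'a::field) ^ n"
proof -
  interpret K: field "ring_of_type_algebra :: 'a ring" by rule
  show ?thesis by (induction n) (simp_all add: mult.commute)
qed

lemma is_subring_iff:
  "is_subring R \<longleftrightarrow> 1 \<in> R \<and> (\<forall>a\<in>R. - a \<in> R) \<and> (\<forall>a\<in>R. \<forall>b\<in>R. a + b \<in> R \<and> a * b \<in> R)"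
  for R :: "'a::field set"
proof -
  interpret K: field "ring_of_type_algebra :: 'a ring" by rule
  show ?thesis (is "?L \<longleftrightarrow> ?R")
  proof
    assume ?L
    then show ?R using subringE(3,5-7)[of R "ring_of_type_algebra :: 'a ring"] by simp
  next
    assume ?R
    then show ?L by (intro K.subringI) simp_all
  qed
qed

lemma is_subringD:
  assumes "is_subring R"
  shows is_subring_1: "1 \<in> R" and is_subring_0: "0 \<in> R"
    and is_subring_uminus: "a \<in> R \<Longrightarrow> - a \<in> R"
    and is_subring_add: "a \<in> R \<Longrightarrow> b \<in> R \<Longrightarrow> a + b \<in> R"
    and is_subring_diff: "a \<in> R \<Longrightarrow> b \<in> R \<Longrightarrow> a - b \<in> R"
    and is_subring_mult: "a \<in> R \<Longrightarrow> b \<in> R \<Longrightarrow> a * b \<in> R"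
    and is_subring_power: "a \<in> R \<Longrightarrow> a ^ n \<in> R"
proof -
  show one: "1 \<in> R" and uminus: "a \<in> R \<Longrightarrow> - a \<in> R" for a
    using assms by (simp_all add: is_subring_iff)
  show add: "a \<in> R \<Longrightarrow> b \<in> R \<Longrightarrow> a + b \<in> R" and mult: "a \<in> R \<Longrightarrow> b \<in> R \<Longrightarrow> a * b \<in> R" for a b
    using assms by (simp_all add: is_subring_iff)
  show "0 \<in> R" using add[OF one uminus[OF one]] by simp
  show "a \<in> R \<Longrightarrow> b \<in> R \<Longrightarrow> a - b \<in> R" using add[of a "- b"] uminus[of b] by simp
  show "a \<in> R \<Longrightarrow> a ^ n \<in> R" by (induction n) (simp_all add: one mult)
qed

lemma is_subring_sum: "is_subring R \<Longrightarrow> (\<And>i. i \<in> I \<Longrightarrow> g i \<in> R) \<Longrightarrow> sum g I \<in> R"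
  by (induction I rule: infinite_finite_induct) (auto simp: is_subringD)

lemma is_subfield_iff:
  "is_subfield E \<longleftrightarrow> is_subring E \<and> (\<forall>a\<in>E. inverse a \<in> E)"
  for E :: "'a::field set"
proof -
  interpret K: field "ring_of_type_algebra :: 'a ring" by rule
  show ?thesis (is "?L \<longleftrightarrow> ?R")
  proof
    assume L: ?L
    have "inverse a \<in> E" if "a \<in> E" for a
    proof (cases "a = 0")
      case False
      then show ?thesis using K.subfield_m_inv(1)[OF L, of a] that by simp
    qed (use that in simp)
    then show ?R using subfieldE(1)[OF L] by blast
  next
    assume ?R
    then show ?L by (intro K.subfieldI') auto
  qed
qed

lemma generate_ring_least:
  assumes "is_subring R" "S \<subseteq> R"
  shows "generate_ring ring_of_type_algebra S \<subseteq> (R :: 'a::field set)"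
proof -
  interpret K: field "ring_of_type_algebra :: 'a ring" by rule
  show ?thesis using K.generate_ring_min_subring1[of S R] assms by simp
qed

lemma generate_ring_subring: "is_subring (generate_ring ring_of_type_algebra (S :: 'a::field set))"
proof -
  interpret K: field "ring_of_type_algebra :: 'a ring" by rule
  show ?thesis using K.generate_ring_is_subring[of S] by simp
qed

lemma generate_field_least:
  assumes "is_subfield E" "S \<subseteq> E"
  shows "generate_field ring_of_type_algebra S \<subseteq> (E :: 'a::field set)"
proof -
  interpret K: field "ring_of_type_algebra :: 'a ring" by rule
  show ?thesis using K.generate_field_min_subfield1[of S E] assms by simp
qed

lemma generate_field_subfield: "is_subfield (generate_field ring_of_type_algebra (S :: 'a::field set))"
proof -
  interpret K: field "ring_of_type_algebra :: 'a ring" by rule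
  show ?thesis using K.generate_field_is_subfield[of S] by simp
qed

section \<open>Rings of fractions\<close>

text \<open>A zero denominator does no harm: it only contributes the quotient 0.\<close>
definition quots :: "'a::field set \<Rightarrow> 'a set" where
  "quots R = {a / b | a b. a \<in> R \<and> b \<in> R}"

lemma quotsI: "x = a / b \<Longrightarrow> a \<in> R \<Longrightarrow> b \<in> R \<Longrightarrow> x \<in> quots R"
  unfolding quots_def by blast

lemma subset_quots: "is_subring R \<Longrightarrow> R \<subseteq> quots R"
  by (auto intro: quotsI[of _ _ 1] is_subring_1)

lemma quots_subfield:
  assumes R: "is_subring R" shows "is_subfield (quots R)"
proof -
  have add: "x + y \<in> quots R" if xy: "x \<in> quots R" "y \<in> quots R" for x y
  proof -
    obtain a b c d where *: "x = a / b" "y = c / d" "a \<in> R" "b \<in> R" "c \<in> R" "d \<in> R"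
      using xy unfolding quots_def by blast
    show ?thesis
    proof (cases "b = 0 \<or> d = 0")
      case True
      then show ?thesis using * xy by auto
    next
      case False
      then have "x + y = (a * d + c * b) / (b * d)" using * by (simp add: field_simps)
      then show ?thesis
        by (rule quotsI) (use * in \<open>simp_all add: is_subring_add[OF R] is_subring_mult[OF R]\<close>)
    qed
  qed
  have mult: "x * y \<in> quots R" if xy: "x \<in> quots R" "y \<in> quots R" for x y
  proof -
    obtain a b c d where *: "x = a / b" "y = c / d" "a \<in> R" "b \<in> R" "c \<in> R" "d \<in> R"
      using xy unfolding quots_def by blast
    then have "x * y = (a * c) / (b * d)" by simp
    then show ?thesis by (rule quotsI) (use * is_subring_mult[OF R] in auto)
  qed
  have uminus: "- x \<in> quots R" if x: "x \<in> quots R" for x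
  proof -
    obtain a b where *: "x = a / b" "a \<in> R" "b \<in> R" using x unfolding quots_def by blast
    then have "- x = (- a) / b" by simp
    then show ?thesis by (rule quotsI) (use * is_subring_uminus[OF R] in auto)
  qed
  have inv: "inverse x \<in> quots R" if x: "x \<in> quots R" for x
  proof -
    obtain a b where *: "x = a / b" "a \<in> R" "b \<in> R" using x unfolding quots_def by blast
    then have "inverse x = b / a" by simp
    then show ?thesis by (rule quotsI) (use * in auto)
  qed
  have "1 \<in> quots R" using subset_quots[OF R] is_subring_1[OF R] by blast
  then show ?thesis using add mult uminus inv by (auto simp: is_subfield_iff is_subring_iff)
qed

lemma quots_least: "is_subfield E \<Longrightarrow> R \<subseteq> E \<Longrightarrow> quots R \<subseteq> E"
  unfolding quots_def is_subfield_iff divide_inverse by (blast intro: is_subring_mult)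

lemma quots_nonzero_denom:
  assumes "is_subring R" "u \<in> quots R"
  obtains a b where "u = a / b" "a \<in> R" "b \<in> R" "b \<noteq> 0"
proof -
  obtain a b where ab: "u = a / b" "a \<in> R" "b \<in> R" using assms by (auto simp: quots_def)
  show ?thesis
  proof (cases "b = 0")
    case True
    then show ?thesis using that[of 0 1] ab is_subringD[OF assms(1)] by auto
  qed (use ab that in blast)
qed

lemma generate_field_eq_quots:
  fixes S :: "'a::field set"
  defines "R \<equiv> generate_ring ring_of_type_algebra S" and "E \<equiv> generate_field ring_of_type_algebra S"
  shows "E = quots R"
proof
  have R: "is_subring R" unfolding R_def by (rule generate_ring_subring)
  have E: "is_subfield E" unfolding E_def by (rule generate_field_subfield)
  have "S \<subseteq> R" unfolding R_def by (auto intro: generate_ring.incl)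
  then show "E \<subseteq> quots R" unfolding E_def
    using generate_field_least[OF quots_subfield[OF R]] subset_quots[OF R] by (meson order_trans)
  have "S \<subseteq> E" unfolding E_def by (auto intro: generate_field.incl)
  then have "R \<subseteq> E" unfolding R_def by (rule generate_ring_least[OF subfieldE(1)[OF E]])
  then show "quots R \<subseteq> E" by (rule quots_least[OF E])
qed

text \<open>The denominators are taken from a multiplicatively closed set M: all nonzero elements of R for
  the field of fractions, the powers of f for the localisation at f.\<close>
lemma common_denominator:
  assumes R: "is_subring R"
    and M: "1 \<in> M" "M \<subseteq> R" "\<And>a b. a \<in> M \<Longrightarrow> b \<in> M \<Longrightarrow> a * b \<in> M"
    and "finite A" "\<And>a. a \<in> A \<Longrightarrow> \<exists>d\<in>M. d * a \<in> R"
  shows "\<exists>d\<in>M. \<forall>a\<in>A. d * a \<in> R"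
  using assms(5,6)
proof (induction A rule: finite_induct)
  case empty
  then show ?case using M by blast
next
  case (insert x A)
  obtain d where d: "d \<in> M" "\<forall>a\<in>A. d * a \<in> R" using insert by blast
  obtain e where e: "e \<in> M" "e * x \<in> R" using insert by blast
  have "d * e * a \<in> R" if "a \<in> insert x A" for a
  proof (cases "a = x")
    case True
    then show ?thesis using d e M is_subring_mult[OF R, of d "e * x"] by (auto simp: mult.assoc)
  next
    case False
    then have "d * a \<in> R" "e \<in> R" using that d e M by auto
    then show ?thesis using is_subring_mult[OF R, of e "d * a"] by (simp add: mult_ac)
  qed
  then show ?case using d e M by blast
qed

section \<open>Polynomials over a subring\<close>

definition polys_over :: "'a::zero set \<Rightarrow> 'a poly set" where
  "polys_over R = {p. \<forall>i. coeff p i \<in> R}"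

lemma polys_over_mono: "R \<subseteq> S \<Longrightarrow> polys_over R \<subseteq> polys_over S"
  by (auto simp: polys_over_def)

lemma polys_over_closed:
  assumes R: "is_subring R"
  shows polys_over_0: "0 \<in> polys_over R" and polys_over_1: "1 \<in> polys_over R"
    and polys_over_add: "p \<in> polys_over R \<Longrightarrow> q \<in> polys_over R \<Longrightarrow> p + q \<in> polys_over R"
    and polys_over_diff: "p \<in> polys_over R \<Longrightarrow> q \<in> polys_over R \<Longrightarrow> p - q \<in> polys_over R"
    and polys_over_uminus: "p \<in> polys_over R \<Longrightarrow> - p \<in> polys_over R"
    and polys_over_mult: "p \<in> polys_over R \<Longrightarrow> q \<in> polys_over R \<Longrightarrow> p * q \<in> polys_over R"
    and polys_over_monom: "c \<in> R \<Longrightarrow> monom c n \<in> polys_over R"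
  by (auto simp: polys_over_def coeff_mult is_subringD[OF R] intro!: is_subring_sum[OF R])

lemma polys_over_power: "is_subring R \<Longrightarrow> p \<in> polys_over R \<Longrightarrow> p ^ n \<in> polys_over R"
  by (induction n) (auto simp: polys_over_closed)

lemma polys_over_sum: "is_subring R \<Longrightarrow> (\<And>i. i \<in> I \<Longrightarrow> g i \<in> polys_over R) \<Longrightarrow> sum g I \<in> polys_over R"
  by (induction I rule: infinite_finite_induct) (auto simp: polys_over_closed)

lemma poly_in_subring:
  assumes "is_subring R" "p \<in> polys_over R" "y \<in> R" shows "poly p y \<in> R"
  using assms unfolding poly_altdef polys_over_def
  by (intro is_subring_sum) (auto simp: is_subringD)

lemma polys_over_clear_denominators:
  assumes R: "is_subring R" and p: "p \<in> polys_over (quots R)"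
  obtains d where "d \<in> R" "d \<noteq> 0" "smult d p \<in> polys_over R"
proof -
  have "\<exists>d\<in>R - {0}. \<forall>a\<in>coeff p ` {..degree p}. d * a \<in> R"
  proof (rule common_denominator[OF R])
    fix a assume "a \<in> coeff p ` {..degree p}"
    then have "a \<in> quots R" using p by (auto simp: polys_over_def)
    then obtain b c where "a = b / c" "b \<in> R" "c \<in> R" "c \<noteq> 0"
      using quots_nonzero_denom[OF R] by metis
    then show "\<exists>d\<in>R - {0}. d * a \<in> R" by (intro bexI[of _ c]) auto
  qed (auto simp: is_subringD[OF R])
  then obtain d where d: "d \<in> R" "d \<noteq> 0" "\<forall>i\<le>degree p. d * coeff p i \<in> R" by auto
  have "d * coeff p i \<in> R" for i
    using d(3) is_subring_0[OF R] by (cases "i \<le> degree p") (auto simp: coeff_eq_0)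
  then show ?thesis using that[of d] d by (simp add: polys_over_def)
qed

text \<open>The leading coefficient of W is the quotient of the leading coefficients of Q * W and Q, so it lies
  in the subfield E; subtracting the leading term from W reduces to smaller degree.\<close>
lemma polys_over_quotient:
  assumes E: "is_subfield E" and Q: "Q \<in> polys_over E" "Q \<noteq> 0" and "Q * W \<in> polys_over E"
  shows "W \<in> polys_over E"
  using assms(4)
proof (induction "degree W" arbitrary: W rule: less_induct)
  case less
  have R: "is_subring E" using E by (simp add: is_subfield_iff)
  define c where "c = lead_coeff W"
  have "coeff (Q * W) (degree Q + degree W) = lead_coeff Q * c"
    unfolding c_def by (rule coeff_mult_degree_sum)
  then have "lead_coeff Q * c \<in> E" using less.prems by (metis mem_Collect_eq polys_over_def)
  moreover have "inverse (lead_coeff Q) \<in> E" using E Q by (auto simp: is_subfield_iff polys_over_def)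
  ultimately have "inverse (lead_coeff Q) * (lead_coeff Q * c) \<in> E" using is_subring_mult[OF R] by blast
  then have c: "c \<in> E" using Q by (simp add: mult.assoc[symmetric])
  define m where "m = monom c (degree W)"
  have m: "m \<in> polys_over E" unfolding m_def by (rule polys_over_monom[OF R c])
  have "W - m \<in> polys_over E"
  proof (cases "degree W = 0")
    case True
    then have "W - m = 0" unfolding m_def c_def by (auto elim!: degree_eq_zeroE simp: monom_0)
    then show ?thesis using polys_over_0[OF R] by simp
  next
    case False
    have "degree (W - m) < degree W"
      using False unfolding m_def c_def
      by (intro degree_lessI) (auto simp: coeff_eq_0)
    moreover have "Q * (W - m) \<in> polys_over E"
      using polys_over_diff[OF R less.prems polys_over_mult[OF R Q(1) m]] by (simp add: algebra_simps)
    ultimately show ?thesis by (rule less.hyps)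
  qed
  then show ?case using polys_over_add[OF R _ m] by fastforce
qed

section \<open>Complete integral closedness\<close>

text \<open>An element u of the field of fractions is called almost integral over R if all its powers have a
  common nonzero denominator d in R. Every integral element of the field of fractions is almost integral,
  so a completely integrally closed ring is integrally closed. Complete integral closedness is the
  better property to carry through an induction: its passage from R to R[y] only needs a look at
  leading coefficients, without roots in extension fields.\<close>
definition completely_integrally_closed :: "'a::field set \<Rightarrow> bool" where
  "completely_integrally_closed R \<longleftrightarrow>
     (\<forall>u\<in>quots R. (\<exists>d\<in>R. d \<noteq> 0 \<and> (\<forall>m::nat. d * u ^ m \<in> R)) \<longrightarrow> u \<in> R)"

lemma polys_over_lead_coeff: "p \<in> polys_over R \<Longrightarrow> lead_coeff p \<in> R"
  by (simp add: polys_over_def)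

text \<open>The leading coefficient c of W is almost integral over R, because the leading coefficient of D is
  a common denominator of its powers; hence c lies in R. Subtracting the leading term of W keeps the
  hypothesis and lowers the degree.\<close>
lemma almost_integral_poly:
  assumes R: "is_subring R" and cic: "completely_integrally_closed R"
    and D: "D \<in> polys_over R" "D \<noteq> 0"
    and "W \<in> polys_over (quots R)" "\<And>m. D * W ^ m \<in> polys_over R"
  shows "W \<in> polys_over R"
  using assms(5,6)
proof (induction "degree W" arbitrary: W rule: less_induct)
  case less
  have E: "is_subring (quots R)" using quots_subfield[OF R] by (rule subfieldE)
  define c where "c = lead_coeff W"
  have "lead_coeff D * c ^ m \<in> R" for m
    using polys_over_lead_coeff[OF less.prems(2)[of m]]
    unfolding c_def by (simp add: lead_coeff_mult lead_coeff_power)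
  then have c: "c \<in> R"
    using cic D less.prems(1) unfolding completely_integrally_closed_def c_def
    by (metis leading_coeff_0_iff polys_over_lead_coeff)
  define v where "v = monom c (degree W)"
  have v: "v \<in> polys_over R" unfolding v_def by (rule polys_over_monom[OF R c])
  \<comment> \<open>The powers of W - v are treated one factor at a time; the extra factor W ^ j makes the induction go through.\<close>
  have "D * W ^ j * (W - v) ^ n \<in> polys_over R" for j n
  proof (induction n arbitrary: j)
    case 0
    then show ?case using less.prems(2) by simp
  next
    case (Suc n)
    have "D * W ^ j * (W - v) ^ Suc n = D * W ^ Suc j * (W - v) ^ n - D * W ^ j * (W - v) ^ n * v"
      by (simp add: algebra_simps)
    then show ?case
      using polys_over_diff[OF R Suc polys_over_mult[OF R Suc v]] by metis
  qed
  from this[of 0] have D': "D * (W - v) ^ n \<in> polys_over R" for n by simp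
  have "W - v \<in> polys_over R"
  proof (cases "degree W = 0")
    case True
    then have "W - v = 0" unfolding v_def c_def by (auto elim!: degree_eq_zeroE simp: monom_0)
    then show ?thesis using polys_over_0[OF R] by simp
  next
    case False
    have "degree (W - v) < degree W"
      using False unfolding v_def c_def by (intro degree_lessI) (auto simp: coeff_eq_0)
    moreover have "W - v \<in> polys_over (quots R)"
      using polys_over_diff[OF E less.prems(1)] v polys_over_mono[OF subset_quots[OF R]] by blast
    ultimately show ?thesis using less.hyps D' by blast
  qed
  then show ?case using polys_over_add[OF R _ v] by fastforce
qed

text \<open>The hypothesis says that the fraction P / Q is almost integral over the polynomial ring. It is
  inherited by S / Q for the remainder S of P modulo Q, and there it forces
  m * degree Q \<le> degree D + m * degree S for all m, which is absurd for m > degree D if S is nonzero,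
  as degree S < degree Q.\<close>
lemma dvd_of_almost_integral:
  fixes P Q D :: "'a::field poly"
  assumes "D \<noteq> 0" "Q \<noteq> 0" and dvd: "\<And>m. Q ^ m dvd D * P ^ m"
  shows "Q dvd P"
proof (rule ccontr)
  assume not_dvd: "\<not> Q dvd P"
  define S where "S = P mod Q"
  have S: "S \<noteq> 0" unfolding S_def using not_dvd by (simp add: dvd_eq_mod_eq_0)
  have deg: "degree S < degree Q"
    unfolding S_def using S assms(2) degree_mod_less S_def by blast
  \<comment> \<open>As for W - v above: P is replaced by S one factor at a time.\<close>
  have "Q ^ (n + j) dvd D * P ^ j * S ^ n" for j n
  proof (induction n arbitrary: j)
    case 0
    then show ?case using dvd by simp
  next
    case (Suc n)
    have "S = P - Q * (P div Q)" by (simp add: S_def minus_mult_div_eq_mod)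
    then have "S ^ Suc n = (P - Q * (P div Q)) * S ^ n" by simp
    then have "D * P ^ j * S ^ Suc n = D * P ^ Suc j * S ^ n - Q * (D * P ^ j * S ^ n) * (P div Q)"
      by (simp only:) (simp add: algebra_simps)
    moreover have "Q ^ (Suc n + j) dvd D * P ^ Suc j * S ^ n" using Suc[of "Suc j"] by simp
    moreover have "Q ^ (Suc n + j) dvd Q * (D * P ^ j * S ^ n) * (P div Q)"
      using mult_dvd_mono[OF dvd_refl Suc[of j], of Q] by simp
    ultimately show ?case by (simp only: dvd_diff)
  qed
  from this[of "Suc (degree D)" 0] have "degree (Q ^ Suc (degree D)) \<le> degree (D * S ^ Suc (degree D))"
    using S assms(1) by (intro dvd_imp_degree_le) auto
  then have "Suc (degree D) * degree Q \<le> degree D + Suc (degree D) * degree S"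
    using S assms(1,2) by (simp add: degree_mult_eq degree_power_eq)
  also have "\<dots> < Suc (degree D) * Suc (degree S)" by simp
  also have "\<dots> \<le> Suc (degree D) * degree Q" using deg by (intro mult_le_mono2) simp
  finally show False by simp
qed

definition adjoin :: "'a::field set \<Rightarrow> 'a \<Rightarrow> 'a set" where
  "adjoin R y = (\<lambda>p. poly p y) ` polys_over R"

lemma adjoin_subring:
  assumes R: "is_subring R" shows "is_subring (adjoin R y)"
  unfolding is_subring_iff
proof (intro conjI ballI)
  show "1 \<in> adjoin R y"
    unfolding adjoin_def using polys_over_1[OF R] by (intro image_eqI[of _ _ 1]) auto
  fix a assume "a \<in> adjoin R y"
  then obtain p where p: "a = poly p y" "p \<in> polys_over R" unfolding adjoin_def by blast
  show "- a \<in> adjoin R y"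
    unfolding adjoin_def using p polys_over_uminus[OF R] by (intro image_eqI[of _ _ "- p"]) auto
  fix b assume "b \<in> adjoin R y"
  then obtain q where q: "b = poly q y" "q \<in> polys_over R" unfolding adjoin_def by blast
  show "a + b \<in> adjoin R y"
    unfolding adjoin_def using p q polys_over_add[OF R] by (intro image_eqI[of _ _ "p + q"]) auto
  show "a * b \<in> adjoin R y"
    unfolding adjoin_def using p q polys_over_mult[OF R] by (intro image_eqI[of _ _ "p * q"]) auto
qed

lemma adjoin_base: "is_subring R \<Longrightarrow> R \<subseteq> adjoin R y"
  unfolding adjoin_def using polys_over_monom[of R _ 0]
  by (intro subsetI image_eqI[of _ _ "monom _ 0"]) (auto simp: monom_0)

lemma adjoin_gen: "is_subring R \<Longrightarrow> y \<in> adjoin R y"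
  unfolding adjoin_def using polys_over_monom[of R 1 1]
  by (intro image_eqI[of _ _ "monom 1 1"]) (auto simp: poly_monom is_subring_1)

lemma adjoin_least: "is_subring S \<Longrightarrow> R \<subseteq> S \<Longrightarrow> y \<in> S \<Longrightarrow> adjoin R y \<subseteq> S"
  unfolding adjoin_def using polys_over_mono[of R S] by (auto intro!: poly_in_subring)

lemma generate_ring_insert:
  fixes S :: "'a::field set"
  shows "generate_ring ring_of_type_algebra (insert y S) = adjoin (generate_ring ring_of_type_algebra S) y"
    (is "?L = adjoin ?R y")
proof
  have R: "is_subring ?R" by (rule generate_ring_subring)
  have "S \<subseteq> ?R" by (auto intro: generate_ring.incl)
  then have "insert y S \<subseteq> adjoin ?R y" using adjoin_base[OF R] adjoin_gen[OF R] by blast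
  then show "?L \<subseteq> adjoin ?R y" by (rule generate_ring_least[OF adjoin_subring[OF R]])
  have L: "is_subring ?L" by (rule generate_ring_subring)
  have "?R \<subseteq> ?L" by (intro generate_ring_least[OF L]) (auto intro: generate_ring.incl)
  then show "adjoin ?R y \<subseteq> ?L" by (intro adjoin_least[OF L]) (auto intro: generate_ring.incl)
qed

text \<open>As y is transcendental over R, statements about R[y] are statements about polynomials over R. An
  almost integral fraction P(y) / Q(y) is first seen to be a polynomial W in y over the field of
  fractions of R, since P / Q is almost integral over a ring of polynomials over a field, and then the
  coefficients of W are pushed down into R.\<close>
theorem completely_integrally_closed_adjoin:
  assumes R: "is_subring R" and cic: "completely_integrally_closed R"
    and trans: "\<And>p. p \<in> polys_over R \<Longrightarrow> poly p y = 0 \<Longrightarrow> p = 0"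
  shows "completely_integrally_closed (adjoin R y)"
  unfolding completely_integrally_closed_def
proof (intro ballI impI)
  fix u assume u: "u \<in> quots (adjoin R y)"
    and ex: "\<exists>d\<in>adjoin R y. d \<noteq> 0 \<and> (\<forall>m. d * u ^ m \<in> adjoin R y)"
  obtain P Q where PQ: "u = poly P y / poly Q y" "P \<in> polys_over R" "Q \<in> polys_over R" "poly Q y \<noteq> 0"
    using quots_nonzero_denom[OF adjoin_subring[OF R] u] unfolding adjoin_def by blast
  obtain D where D: "D \<in> polys_over R" "poly D y \<noteq> 0" "\<And>m. poly D y * u ^ m \<in> adjoin R y"
    using ex unfolding adjoin_def by blast
  have [simp]: "D \<noteq> 0" "Q \<noteq> 0" using D PQ by auto
  have *: "\<exists>r\<in>polys_over R. D * P ^ m = Q ^ m * r" for m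
  proof -
    obtain r where r: "r \<in> polys_over R" "poly D y * u ^ m = poly r y"
      using D(3)[of m] unfolding adjoin_def by blast
    have "poly (D * P ^ m - Q ^ m * r) y = 0"
      using r(2) PQ(1,4) by (simp add: field_simps power_divide)
    moreover have "D * P ^ m - Q ^ m * r \<in> polys_over R"
      using D PQ r by (intro polys_over_diff polys_over_mult polys_over_power R)
    ultimately show ?thesis using trans r(1) by (metis right_minus_eq)
  qed
  then have "Q ^ m dvd D * P ^ m" for m by (metis dvd_triv_left)
  then have "Q dvd P" by (rule dvd_of_almost_integral[rotated 2]) auto
  then obtain W where W: "P = Q * W" by blast
  have "P \<in> polys_over (quots R)" "Q \<in> polys_over (quots R)"
    using PQ polys_over_mono[OF subset_quots[OF R]] by auto
  then have W': "W \<in> polys_over (quots R)"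
    using polys_over_quotient[OF quots_subfield[OF R], of Q W] by (simp add: W)
  have "D * W ^ m \<in> polys_over R" for m
  proof -
    obtain r where "r \<in> polys_over R" "D * P ^ m = Q ^ m * r" using * by blast
    then show ?thesis by (simp add: W power_mult_distrib mult_ac)
  qed
  then have "W \<in> polys_over R" by (rule almost_integral_poly[OF R cic D(1) _ W', rotated]) simp
  moreover have "u = poly W y" using PQ W by simp
  ultimately show "u \<in> adjoin R y" unfolding adjoin_def by blast
qed

lemma completely_integrally_closed_subfield:
  "is_subfield E \<Longrightarrow> completely_integrally_closed E"
  using quots_least[of E E] unfolding completely_integrally_closed_def by auto

text \<open>If v = s / t is a root of a monic polynomial of degree n, then t ^ n is a common denominator of
  1, v, ..., v ^ n, and the higher powers of v are combinations of lower ones with coefficients in R.\<close>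
lemma integral_imp_almost_integral:
  assumes R: "is_subring R" and v: "v \<in> quots R"
    and p: "p \<in> polys_over R" "lead_coeff p = 1" "poly p v = 0"
  shows "\<exists>d\<in>R. d \<noteq> 0 \<and> (\<forall>m. d * v ^ m \<in> R)"
proof -
  obtain s t where st: "v = s / t" "s \<in> R" "t \<in> R" "t \<noteq> 0" by (rule quots_nonzero_denom[OF R v])
  define n where "n = degree p"
  have "t ^ n * v ^ m \<in> R" for m
  proof (induction m rule: less_induct)
    case (less m)
    show ?case
    proof (cases "m \<le> n")
      case True
      then have "t ^ n * v ^ m = t ^ (n - m) * (t * v) ^ m"
        by (simp add: power_mult_distrib mult.assoc[symmetric] flip: power_add)
      also have "t * v = s" using st by simp
      finally have "t ^ n * v ^ m = t ^ (n - m) * s ^ m" .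
      then show ?thesis using st by (simp add: is_subringD[OF R])
    next
      case False
      have "0 = (\<Sum>i\<le>n. coeff p i * v ^ i)" using p(3) by (simp add: poly_altdef n_def)
      also have "\<dots> = (\<Sum>i<n. coeff p i * v ^ i) + v ^ n"
        using p(2) by (simp add: n_def flip: lessThan_Suc_atMost)
      finally have "v ^ n = - (\<Sum>i<n. coeff p i * v ^ i)" by (simp add: eq_neg_iff_add_eq_0 add.commute)
      then have "t ^ n * (v ^ (m - n) * v ^ n) = - (\<Sum>i<n. coeff p i * (t ^ n * v ^ (m - n + i)))"
        by (simp add: sum_distrib_left power_add mult_ac)
      moreover have "v ^ (m - n) * v ^ n = v ^ m" using False by (simp flip: power_add)
      moreover have "(\<Sum>i<n. coeff p i * (t ^ n * v ^ (m - n + i))) \<in> R"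
      proof (rule is_subring_sum[OF R])
        fix i assume "i \<in> {..<n}"
        then have "t ^ n * v ^ (m - n + i) \<in> R" using False by (intro less.IH) auto
        then show "coeff p i * (t ^ n * v ^ (m - n + i)) \<in> R"
          using p(1) by (intro is_subring_mult[OF R, of "coeff p i"]) (simp_all add: polys_over_def)
      qed
      ultimately show ?thesis using is_subring_uminus[OF R] by simp
    qed
  qed
  then show ?thesis using st is_subring_power[OF R] by (intro bexI[of _ "t ^ n"]) auto
qed

section \<open>Integral elements over a localisation\<close>

lemma adjoin_inverse_eq:
  assumes R: "is_subring R" and f: "f \<in> R" "f \<noteq> 0"
  shows "adjoin_inverse R f = {a / f ^ n | a n. a \<in> R}" (is "_ = ?L")
proof
  have "is_subring ?L"
    unfolding is_subring_iff
  proof (intro conjI ballI)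
    show "1 \<in> ?L" using is_subring_1[OF R] by (intro CollectI exI[of _ 1] exI[of _ "0::nat"]) simp
    fix x assume "x \<in> ?L"
    then obtain a m where x: "x = a / f ^ m" "a \<in> R" by blast
    then show "- x \<in> ?L" by (intro CollectI exI[of _ "- a"] exI[of _ m]) (simp add: is_subring_uminus[OF R])
    fix y assume "y \<in> ?L"
    then obtain b n where y: "y = b / f ^ n" "b \<in> R" by blast
    have "x + y = (a * f ^ n + b * f ^ m) / f ^ (m + n)"
      using x y f by (simp add: add_divide_distrib power_add)
    moreover have "a * f ^ n + b * f ^ m \<in> R" using x y f by (simp add: is_subringD[OF R])
    ultimately show "x + y \<in> ?L" by blast
    have "x * y = (a * b) / f ^ (m + n)" using x y by (simp add: power_add)
    moreover have "a * b \<in> R" using x y by (simp add: is_subringD[OF R])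
    ultimately show "x * y \<in> ?L" by blast
  qed
  moreover have "R \<union> {inverse f} \<subseteq> ?L"
  proof (intro Un_least subsetI)
    fix a assume "a \<in> R"
    then show "a \<in> ?L" by (intro CollectI exI[of _ a] exI[of _ "0::nat"]) simp
  next
    fix a assume "a \<in> {inverse f}"
    then show "a \<in> ?L" using is_subring_1[OF R] by (intro CollectI exI[of _ 1] exI[of _ "1::nat"]) (simp add: divide_inverse)
  qed
  ultimately show "adjoin_inverse R f \<subseteq> ?L"
    unfolding adjoin_inverse_def by (rule generate_ring_least)
  have A: "is_subring (adjoin_inverse R f)"
    unfolding adjoin_inverse_def by (rule generate_ring_subring)
  have "R \<subseteq> adjoin_inverse R f" "inverse f \<in> adjoin_inverse R f"
    unfolding adjoin_inverse_def by (auto intro: generate_ring.incl)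
  then show "?L \<subseteq> adjoin_inverse R f"
    by (auto simp: divide_inverse subset_iff simp flip: power_inverse intro!: is_subring_mult[OF A] is_subring_power[OF A])
qed

text \<open>Complete integral closedness need not pass to localisations, but integral closedness does: if
  f ^ N clears the denominators of the coefficients of the monic equation of u, then f ^ N * u
  satisfies a monic equation over R itself, so f ^ N * u lies in R.\<close>
theorem integral_in_localisation:
  assumes R: "is_subring R" and cic: "completely_integrally_closed R"
    and f: "f \<in> R" "f \<noteq> 0" and u: "u \<in> quots R"
    and p: "p \<in> polys_over (adjoin_inverse R f)" "lead_coeff p = 1" "poly p u = 0"
  shows "u \<in> adjoin_inverse R f"
proof -
  have "\<exists>d\<in>range (\<lambda>n. f ^ n). \<forall>a\<in>coeff p ` {..degree p}. d * a \<in> R"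
  proof (rule common_denominator[OF R])
    show "1 \<in> range (\<lambda>n. f ^ n)" by (metis power_0 rangeI)
    show "range (\<lambda>n. f ^ n) \<subseteq> R" using f by (auto simp: is_subringD[OF R])
    show "a * b \<in> range (\<lambda>n. f ^ n)" if "a \<in> range (\<lambda>n. f ^ n)" "b \<in> range (\<lambda>n. f ^ n)" for a b
      using that by (auto simp flip: power_add)
    fix a assume "a \<in> coeff p ` {..degree p}"
    then have "a \<in> adjoin_inverse R f" using p by (auto simp: polys_over_def)
    then obtain b n where "a = b / f ^ n" "b \<in> R" using adjoin_inverse_eq[OF R f] by auto
    then show "\<exists>d\<in>range (\<lambda>n. f ^ n). d * a \<in> R" using f by (intro bexI[of _ "f ^ n"]) auto
  qed simp
  then obtain N where N: "\<And>i. i \<le> degree p \<Longrightarrow> f ^ N * coeff p i \<in> R" by auto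
  define n where "n = degree p"
  define c where "c = f ^ N"
  have c: "c \<in> R" "c \<noteq> 0" using f by (auto simp: c_def is_subringD[OF R])
  \<comment> \<open>Scaling the root of a monic polynomial of degree n by c scales the i-th coefficient by c ^ (n - i).\<close>
  define q where "q = (\<Sum>i\<le>n. monom (c ^ (n - i) * coeff p i) i)"
  have coeff_q: "coeff q i = (if i \<le> n then c ^ (n - i) * coeff p i else 0)" for i
    unfolding q_def by (simp add: coeff_sum)
  have "coeff q i \<in> R" for i
  proof -
    consider "i < n" | "i = n" | "i > n" by linarith
    then show ?thesis
    proof cases
      case 1
      then have *: "c ^ (n - i) * coeff p i = c ^ (n - Suc i) * (c * coeff p i)"
        by (metis Suc_diff_Suc mult.assoc power_Suc2)
      moreover have "c * coeff p i \<in> R" using 1 N[of i] by (simp add: c_def n_def)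
      ultimately show ?thesis
        unfolding coeff_q * using 1 c by (simp add: is_subringD[OF R])
    qed (use p in \<open>auto simp: coeff_q n_def is_subringD[OF R]\<close>)
  qed
  then have q: "q \<in> polys_over R" by (simp add: polys_over_def)
  have deg: "degree q = n"
  proof (rule antisym)
    show "degree q \<le> n" by (rule degree_le) (simp add: coeff_q)
    show "n \<le> degree q" using p(2) by (intro le_degree) (simp add: coeff_q n_def)
  qed
  have lead: "lead_coeff q = 1" using p(2) by (simp add: deg coeff_q n_def)
  have "poly q (c * u) = (\<Sum>i\<le>n. c ^ n * (coeff p i * u ^ i))"
    unfolding q_def poly_sum
  proof (rule sum.cong)
    fix i assume "i \<in> {..n}"
    then have "c ^ n = c ^ (n - i) * c ^ i" by (simp flip: power_add)
    then show "poly (monom (c ^ (n - i) * coeff p i) i) (c * u) = c ^ n * (coeff p i * u ^ i)"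
      by (simp add: poly_monom power_mult_distrib)
  qed simp
  also have "\<dots> = c ^ n * poly p u" by (simp add: poly_altdef n_def sum_distrib_left)
  finally have root: "poly q (c * u) = 0" using p(3) by simp
  have cu: "c * u \<in> quots R"
    using subset_quots[OF R] c u is_subring_mult[OF subfieldE(1)[OF quots_subfield[OF R]]] by blast
  have "c * u \<in> R"
    using integral_imp_almost_integral[OF R cu q lead root] cic cu
    unfolding completely_integrally_closed_def by blast
  moreover have "u = (c * u) / f ^ N" using c by (simp add: c_def)
  ultimately show ?thesis using adjoin_inverse_eq[OF R f] by blast
qed

section \<open>Algebraic elements\<close>

definition algebraic_over :: "'a::field set \<Rightarrow> 'a \<Rightarrow> bool" where
  "algebraic_over E x \<longleftrightarrow> (\<exists>p\<in>polys_over E. p \<noteq> 0 \<and> poly p x = 0)"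

lemma algebraic_over_mono: "E \<subseteq> E' \<Longrightarrow> algebraic_over E x \<Longrightarrow> algebraic_over E' x"
  unfolding algebraic_over_def using polys_over_mono[of E E'] by auto

lemma algebraic_over_quots:
  assumes R: "is_subring R" and "algebraic_over (quots R) x"
  shows "algebraic_over R x"
proof -
  obtain p where p: "p \<in> polys_over (quots R)" "p \<noteq> 0" "poly p x = 0"
    using assms(2) unfolding algebraic_over_def by auto
  obtain d where "d \<noteq> 0" "smult d p \<in> polys_over R"
    by (rule polys_over_clear_denominators[OF R p(1)])
  then show ?thesis using p unfolding algebraic_over_def by (intro bexI[of _ "smult d p"]) auto
qed

text \<open>In the ring locale a polynomial is the list of its coefficients, the leading coefficient first. The
  translation gives access to the theory of finite extensions, which yields transitivity below.\<close>
lemma eval_eq_poly_rev: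
  "ring.eval ring_of_type_algebra ps x = poly (Poly (rev ps)) (x :: 'a::field)"
proof -
  interpret K: field "ring_of_type_algebra :: 'a ring" by rule
  show ?thesis
    by (induction ps) (simp_all add: Poly_append poly_monom mult.commute monom_0)
qed

lemma algebraic_over_iff_ring_algebraic:
  fixes E :: "'a::field set"
  assumes E: "is_subring E"
  shows "algebraic_over E x \<longleftrightarrow> (ring.algebraic ring_of_type_algebra over E) x"
proof -
  interpret K: field "ring_of_type_algebra :: 'a ring" by rule
  show ?thesis
  proof
    assume "algebraic_over E x"
    then obtain p where p: "p \<in> polys_over E" "p \<noteq> 0" "poly p x = 0"
      unfolding algebraic_over_def by auto
    have "set (rev (coeffs p)) \<subseteq> E"
      using p(1,2) by (auto simp: polys_over_def coeffs_def)
    moreover have "hd (rev (coeffs p)) \<noteq> 0" "rev (coeffs p) \<noteq> []"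
      using p(2) by (simp_all add: hd_rev last_coeffs_eq_coeff_degree)
    ultimately have "rev (coeffs p) \<in> carrier (univ_poly ring_of_type_algebra E)"
      unfolding univ_poly_def polynomial_def by simp
    moreover have "ring.eval ring_of_type_algebra (rev (coeffs p)) x = 0"
      using p(3) by (simp add: eval_eq_poly_rev)
    ultimately show "(K.algebraic over E) x"
      using K.algebraicI[of "rev (coeffs p)" E x] p(2) by simp
  next
    assume "(K.algebraic over E) x"
    then obtain p where p: "p \<in> carrier (univ_poly ring_of_type_algebra E)" "p \<noteq> []"
      "ring.eval ring_of_type_algebra p x = 0"
      using K.algebraicE[OF E, of x] by auto
    then have *: "set p \<subseteq> E" "hd p \<noteq> 0"
      unfolding univ_poly_def polynomial_def by auto
    have "coeff (Poly (rev p)) i \<in> E" for i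
      using *(1) is_subring_0[OF E] nth_mem[of i "rev p"] by (auto simp: nth_default_def simp del: nth_mem)
    then have "Poly (rev p) \<in> polys_over E" by (simp add: polys_over_def)
    moreover have "coeff (Poly (rev p)) (length p - 1) = hd p"
      using p(2) by (simp add: nth_default_def rev_nth hd_conv_nth)
    then have "Poly (rev p) \<noteq> 0" using *(2) by (metis coeff_0)
    ultimately show "algebraic_over E x"
      using p(3) unfolding algebraic_over_def eval_eq_poly_rev by blast
  qed
qed

lemma algebraic_elements_subfield:
  assumes E: "is_subfield E" shows "is_subfield {x. algebraic_over E x}"
proof -
  interpret K: field "ring_of_type_algebra :: 'a ring" by rule
  show ?thesis
    using K.subfield_of_algebraics[OF E] algebraic_over_iff_ring_algebraic[OF subfieldE(1)[OF E]]
    by (simp add: over_def)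
qed

lemma algebraic_over_base: "is_subring E \<Longrightarrow> x \<in> E \<Longrightarrow> algebraic_over E x"
  unfolding algebraic_over_def
  by (intro bexI[of _ "[:-x, 1:]"])
     (auto simp: polys_over_def coeff_pCons is_subringD split: nat.split)

text \<open>The coefficients of an equation for x generate a finite extension L of E, and L(x) is finite over L;
  so L(x) is finite over E.\<close>
lemma algebraic_over_trans:
  fixes E :: "'a::field set"
  assumes E: "is_subfield E" and x: "algebraic_over {y. algebraic_over E y} x"
  shows "algebraic_over E x"
proof -
  interpret K: field "ring_of_type_algebra :: 'a ring" by rule
  note iff = algebraic_over_iff_ring_algebraic
  have ER: "is_subring E" by (rule subfieldE(1)[OF E])
  obtain p where p: "\<And>i. algebraic_over E (coeff p i)" "p \<noteq> 0" "poly p x = 0"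
    using x unfolding algebraic_over_def polys_over_def by auto
  define as where "as = coeffs p"
  have as: "(K.algebraic over E) a" if "a \<in> set as" for a
    using that p iff[OF ER] unfolding as_def coeffs_def by auto
  define L where "L = K.finite_extension E as"
  have L: "is_subfield L" unfolding L_def by (rule K.finite_extension_is_subfield[OF E _ as]) simp
  have dimL: "K.finite_dimension E L"
    unfolding L_def by (rule K.finite_extension_finite_dimension(1)[OF E _ as]) simp
  have "set as \<subseteq> L" unfolding L_def by (rule K.finite_extension_mem[OF ER]) simp
  then have "coeff p i \<in> L" for i
    using is_subring_0[OF subfieldE(1)[OF L]]
    unfolding as_def by (metis coeff_in_coeffs coeff_eq_0 le_degree subset_iff p(2))
  then have "algebraic_over L x" using p unfolding algebraic_over_def polys_over_def by blast
  then have algx: "(K.algebraic over L) x" using iff[OF subfieldE(1)[OF L]] by blast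
  define M where "M = K.simple_extension L x"
  have M: "is_subring M" "x \<in> M" unfolding M_def
    using K.simple_extension_is_subring[OF subfieldE(1)[OF L], of x]
      K.simple_extension_mem[OF subfieldE(1)[OF L], of x] by simp_all
  have "K.finite_dimension L M"
    unfolding M_def using K.finite_dimension_simple_extension[OF L, of x] algx by simp
  then have "K.finite_dimension E M" by (rule K.telescopic_base_dim(1)[OF E L dimL])
  then have "(K.algebraic over E) x" by (rule K.finite_dimension_imp_algebraic[OF E M(1) _ M(2)])
  then show ?thesis using iff[OF ER] by blast
qed

text \<open>An equation for a over R[b] is a polynomial relation between a and b over R. Sorted by powers of b
  it becomes an equation for b over R[a]; it is not the zero equation, because its coefficients are
  values at a of polynomials over R, and a is not algebraic over R.\<close>
lemma algebraic_over_exchange: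
  assumes R: "is_subring R" and a: "algebraic_over (adjoin R b) a" and na: "\<not> algebraic_over R a"
  shows "algebraic_over (adjoin R a) b"
proof -
  obtain p where p: "\<And>i. coeff p i \<in> adjoin R b" "p \<noteq> 0" "poly p a = 0"
    using a unfolding algebraic_over_def polys_over_def by auto
  have "\<exists>q. q \<in> polys_over R \<and> coeff p i = poly q b" for i
    using p(1)[of i] unfolding adjoin_def by auto
  then obtain Q where Q: "\<And>i. Q i \<in> polys_over R" "\<And>i. coeff p i = poly (Q i) b" by metis
  define n where "n = degree p"
  \<comment> \<open>W is the given equation for a as a polynomial in b; its j-th coefficient is T j evaluated at a.\<close>
  define W where "W = (\<Sum>i\<le>n. smult (a ^ i) (Q i))"
  define T where "T j = (\<Sum>i\<le>n. monom (coeff (Q i) j) i)" for j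
  have T: "T j \<in> polys_over R" for j
    unfolding T_def using Q(1) by (intro polys_over_sum[OF R] polys_over_monom[OF R]) (simp add: polys_over_def)
  have coeff_W: "coeff W j = poly (T j) a" for j
    unfolding W_def T_def by (simp add: coeff_sum poly_sum poly_monom mult.commute)
  have "poly W b = (\<Sum>i\<le>n. coeff p i * a ^ i)"
    unfolding W_def by (simp add: poly_sum Q(2) mult.commute)
  also have "\<dots> = 0" using p(3) by (simp add: poly_altdef n_def)
  finally have "poly W b = 0" .
  moreover have "W \<in> polys_over (adjoin R a)"
    unfolding adjoin_def polys_over_def[of "_ ` _"] using T coeff_W by blast
  moreover have "W \<noteq> 0"
  proof
    assume "W = 0"
    then have "poly (T j) a = 0" for j using coeff_W[of j] by simp
    then have T0: "T j = 0" for j using na T[of j] unfolding algebraic_over_def by auto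
    have "coeff (Q n) j = coeff (T j) n" for j unfolding T_def by (simp add: coeff_sum)
    then have "Q n = 0" using T0 by (intro poly_eqI) simp
    then show False using Q(2)[of n] p(2) unfolding n_def by simp
  qed
  ultimately show ?thesis unfolding algebraic_over_def by blast
qed

section \<open>Closure operators with exchange\<close>

locale exchange_closure =
  fixes cl :: "'a set \<Rightarrow> 'a set"
  assumes extensive: "S \<subseteq> cl S"
    and mono: "S \<subseteq> T \<Longrightarrow> cl S \<subseteq> cl T"
    and idem: "cl (cl S) \<subseteq> cl S"
    and exchange: "a \<in> cl (insert b S) \<Longrightarrow> a \<notin> cl S \<Longrightarrow> b \<in> cl (insert a S)"
begin

lemma cl_least: "S \<subseteq> cl T \<Longrightarrow> cl S \<subseteq> cl T"
  using mono idem by blast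

text \<open>Steinitz exchange: as long as some x in I lies outside S, some y in S is not in the closure of
  I - {x}, since that closure would otherwise contain x. Replacing x by y keeps I independent, keeps its cardinality and moves it closer to
  S.\<close>
theorem independent_card_le:
  assumes "finite I" "finite S" "\<And>x. x \<in> I \<Longrightarrow> x \<notin> cl (I - {x})" "I \<subseteq> cl S"
  shows "card I \<le> card S"
  using assms
proof (induction "card (I - S)" arbitrary: I rule: less_induct)
  case less
  show ?case
  proof (cases "I \<subseteq> S")
    case True
    then show ?thesis using less.prems by (intro card_mono)
  next
    case False
    then obtain x where x: "x \<in> I" "x \<notin> S" by blast
    define J where "J = I - {x}"
    have "\<not> S \<subseteq> cl J"
    proof
      assume "S \<subseteq> cl J"
      then have "x \<in> cl J" using cl_least[of S J] less.prems(4) x by blast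
      then show False using less.prems(3)[OF x(1)] by (simp add: J_def)
    qed
    then obtain y where y: "y \<in> S" "y \<notin> cl J" by blast
    have yJ: "y \<notin> J" using y extensive[of J] by blast
    define I' where "I' = insert y J"
    have "finite J" using less.prems by (simp add: J_def)
    have I: "I = insert x J" "x \<notin> J" using x by (auto simp: J_def)
    have card: "card I' = card I" using yJ I \<open>finite J\<close> by (simp add: I'_def)
    have "card I' \<le> card S"
    proof (rule less.hyps)
      have "I' - S = (I - S) - {x}" using y x unfolding I'_def J_def by blast
      then show "card (I' - S) < card (I - S)"
        using x less.prems(1) by (metis DiffI card_Diff1_less finite_Diff)
      show "finite I'" using \<open>finite J\<close> by (simp add: I'_def)
      show "I' \<subseteq> cl S" using less.prems(4) y extensive[of S] unfolding I'_def J_def by blast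
      show "z \<notin> cl (I' - {z})" if z: "z \<in> I'" for z
      proof (cases "z = y")
        case True
        then show ?thesis using y yJ by (simp add: I'_def)
      next
        case False
        then have zJ: "z \<in> J" using z by (simp add: I'_def)
        have "J - {z} \<subseteq> I - {z}" by (auto simp: J_def)
        then have nz: "z \<notin> cl (J - {z})" using less.prems(3)[of z] mono zJ I(1) by blast
        have "I' - {z} = insert y (J - {z})" using False by (auto simp: I'_def)
        moreover have "insert z (J - {z}) = J" using zJ by blast
        ultimately show ?thesis using exchange[of z y "J - {z}"] nz y(2) by auto
      qed
    qed (rule less.prems)
    then show ?thesis using card by simp
  qed
qed

end

text \<open>If one member of the family were redundant, fewer than card I elements would span the independent
  set I.\<close>
lemma (in exchange_closure) spanning_family_independent:
  assumes I: "finite I" "\<And>x. x \<in> I \<Longrightarrow> x \<notin> cl (I - {x})"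
    and span: "I \<subseteq> cl (fs ` {..<card I})" and i: "i < card I"
  shows "fs i \<notin> cl (fs ` ({..<card I} - {i}))"
proof
  let ?S = "fs ` ({..<card I} - {i})"
  assume "fs i \<in> cl ?S"
  then have "fs ` {..<card I} \<subseteq> cl ?S" using extensive[of ?S] by auto
  then have "I \<subseteq> cl ?S" using cl_least span by blast
  then have "card I \<le> card ?S" by (intro independent_card_le I) auto
  also have "\<dots> \<le> card ({..<card I} - {i})" by (rule card_image_le) simp
  also have "\<dots> < card I" using i by simp
  finally show False by simp
qed

section \<open>Algebraic independence\<close>

text \<open>The closure operator of the matroid of algebraic independence over C, for a set C that generates
  the ground field.\<close>
definition algebraic_span :: "'a::field set \<Rightarrow> 'a set \<Rightarrow> 'a set" where
  "algebraic_span C S = {x. algebraic_over (generate_field ring_of_type_algebra (C \<union> S)) x}"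

text \<open>Exchange is \<open>algebraic_over_exchange\<close>, applied to the ring generated by C and S, after passing
  from fields of fractions to the rings themselves.\<close>
lemma exchange_closure_algebraic_span: "exchange_closure (algebraic_span (C :: 'a::field set))"
proof
  note gen = generate_field_subfield
  have sub: "C \<union> S \<subseteq> algebraic_span C S" for S
    unfolding algebraic_span_def
    by (intro subsetI CollectI algebraic_over_base[OF subfieldE(1)[OF gen]] generate_field.incl)
  then show "S \<subseteq> algebraic_span C S" for S by blast
  have fld: "is_subfield (algebraic_span C S)" for S
    unfolding algebraic_span_def by (rule algebraic_elements_subfield[OF gen])
  show "algebraic_span C S \<subseteq> algebraic_span C T" if "S \<subseteq> T" for S T
  proof -
    have "generate_field ring_of_type_algebra (C \<union> S) \<subseteq> generate_field ring_of_type_algebra (C \<union> T)"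
      using that by (intro generate_field_least[OF gen]) (auto intro: generate_field.incl)
    then show ?thesis unfolding algebraic_span_def using algebraic_over_mono by auto
  qed
  show "algebraic_span C (algebraic_span C S) \<subseteq> algebraic_span C S" for S
  proof -
    have "generate_field ring_of_type_algebra (C \<union> algebraic_span C S) \<subseteq> algebraic_span C S"
      using sub by (intro generate_field_least[OF fld]) auto
    then have "algebraic_over (algebraic_span C S) x" if "x \<in> algebraic_span C (algebraic_span C S)" for x
      using that algebraic_over_mono unfolding algebraic_span_def[of C "algebraic_span C S"] by blast
    then show ?thesis
      using algebraic_over_trans[OF gen] unfolding algebraic_span_def[of C S] by blast
  qed
  show "b \<in> algebraic_span C (insert a S)"
    if a: "a \<in> algebraic_span C (insert b S)" and na: "a \<notin> algebraic_span C S" for a b S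
  proof -
    define R where "R = generate_ring ring_of_type_algebra (C \<union> S)"
    have R: "is_subring R" unfolding R_def by (rule generate_ring_subring)
    have eq: "generate_field ring_of_type_algebra (C \<union> insert y S) = quots (adjoin R y)" for y
      unfolding generate_field_eq_quots R_def by (simp add: generate_ring_insert)
    have "algebraic_over (adjoin R b) a"
      using a unfolding algebraic_span_def eq by (simp add: algebraic_over_quots adjoin_subring[OF R])
    moreover have "\<not> algebraic_over R a"
      using na algebraic_over_mono[OF subset_quots[OF R]]
      unfolding algebraic_span_def generate_field_eq_quots R_def by blast
    ultimately have "algebraic_over (adjoin R a) b" by (rule algebraic_over_exchange[OF R])
    then show ?thesis
      using algebraic_over_mono[OF subset_quots[OF adjoin_subring[OF R]]]
      unfolding algebraic_span_def eq by blast
  qed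
qed

section \<open>Substitution into polynomials\<close>

definition monomial_at :: "(nat \<Rightarrow> 'f::field mvpoly) \<Rightarrow> (nat \<Rightarrow>\<^sub>0 nat) \<Rightarrow> 'f mvpoly" where
  "monomial_at \<sigma> m = (\<Prod>i\<in>Poly_Mapping.keys m. \<sigma> i ^ Poly_Mapping.lookup m i)"

lemma monomial_at_superset:
  assumes "finite I" "Poly_Mapping.keys m \<subseteq> I"
  shows "monomial_at \<sigma> m = (\<Prod>i\<in>I. \<sigma> i ^ Poly_Mapping.lookup m i)"
  unfolding monomial_at_def using assms
  by (intro prod.mono_neutral_left) (auto simp: in_keys_iff)

lemma monomial_at_add: "monomial_at \<sigma> (m + n) = monomial_at \<sigma> m * monomial_at \<sigma> n"
proof -
  let ?I = "Poly_Mapping.keys m \<union> Poly_Mapping.keys n"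
  have "Poly_Mapping.keys (m + n) \<subseteq> ?I" by (rule Poly_Mapping.keys_add)
  then show ?thesis
    by (simp add: monomial_at_superset[of ?I] lookup_add power_add prod.distrib)
qed

lemma const_poly_simps [simp]:
  "const_poly 0 = 0" "const_poly 1 = 1" "const_poly (a + b) = const_poly a + const_poly b"
  "const_poly (a * b) = const_poly a * const_poly b"
  by (simp_all add: const_poly_def single_add mult_single)

lemma const_poly_sum: "const_poly (sum g I) = (\<Sum>i\<in>I. const_poly (g i))"
  by (induction I rule: infinite_finite_induct) simp_all

lemma subst_poly_altdef:
  "subst_poly \<sigma> p = (\<Sum>m\<in>Poly_Mapping.keys p. const_poly (Poly_Mapping.lookup p m) * monomial_at \<sigma> m)"
  by (simp add: subst_poly_def monomial_at_def)

lemma subst_poly_add [simp]: "subst_poly \<sigma> (p + q) = subst_poly \<sigma> p + subst_poly \<sigma> q"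
  unfolding subst_poly_altdef
  by (rule setsum_keys_plus_distrib[where f = "\<lambda>m c. const_poly c * monomial_at \<sigma> m"])
     (simp_all add: distrib_right)

lemma subst_poly_single: "subst_poly \<sigma> (Poly_Mapping.single m c) = const_poly c * monomial_at \<sigma> m"
  by (cases "c = 0") (simp_all add: subst_poly_altdef)

lemma mvpoly_eq_sum_monomials:
  "p = (\<Sum>m\<in>Poly_Mapping.keys p. Poly_Mapping.single m (Poly_Mapping.lookup p m))"
  by (rule poly_mapping_eqI)
     (simp add: lookup_sum lookup_single when_def in_keys_iff)

lemma mvpoly_induct [case_names monomial add]:
  fixes p :: "'f::field mvpoly"
  assumes "\<And>m c. P (Poly_Mapping.single m c)" "\<And>p q. P p \<Longrightarrow> P q \<Longrightarrow> P (p + q)"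
  shows "P p"
proof -
  have "P (\<Sum>m\<in>I. Poly_Mapping.single m (c m))" if "finite I" for I and c :: "_ \<Rightarrow> 'f"
    using that by (induction I rule: finite_induct) (use assms assms(1)[of _ 0] in auto)
  from this[of "Poly_Mapping.keys p" "Poly_Mapping.lookup p"] show ?thesis
    by (simp flip: mvpoly_eq_sum_monomials)
qed

lemma subst_poly_mult [simp]: "subst_poly \<sigma> (p * q) = subst_poly \<sigma> p * subst_poly \<sigma> q"
proof (induction p rule: mvpoly_induct)
  case (monomial m c)
  show ?case
    by (induction q rule: mvpoly_induct)
       (simp_all add: mult_single subst_poly_single monomial_at_add algebra_simps)
qed (simp add: distrib_right)

lemma subst_poly_const [simp]: "subst_poly \<sigma> (const_poly c) = const_poly c"
  by (simp add: const_poly_def subst_poly_single monomial_at_def flip: single_one)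

lemma subst_poly_var [simp]: "subst_poly \<sigma> (var_poly i) = \<sigma> i"
  by (simp add: var_poly_def subst_poly_single monomial_at_def)

lemma subst_poly_0 [simp]: "subst_poly \<sigma> 0 = 0" and subst_poly_1 [simp]: "subst_poly \<sigma> 1 = 1"
  using subst_poly_const[of \<sigma> 0] subst_poly_const[of \<sigma> 1] by simp_all

lemma subst_poly_uminus [simp]: "subst_poly \<sigma> (- p) = - subst_poly \<sigma> p"
  using subst_poly_add[of \<sigma> p "- p"] by (simp add: eq_neg_iff_add_eq_0 add.commute)

lemma subst_poly_sum: "subst_poly \<sigma> (sum g I) = (\<Sum>i\<in>I. subst_poly \<sigma> (g i))"
  by (induction I rule: infinite_finite_induct) simp_all

lemma subst_poly_prod: "subst_poly \<sigma> (prod g I) = (\<Prod>i\<in>I. subst_poly \<sigma> (g i))"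
  by (induction I rule: infinite_finite_induct) simp_all

lemma subst_poly_power: "subst_poly \<sigma> (p ^ n) = subst_poly \<sigma> p ^ n"
  by (induction n) simp_all

lemma subst_poly_subst_poly:
  "subst_poly \<sigma> (subst_poly \<tau> p) = subst_poly (\<lambda>i. subst_poly \<sigma> (\<tau> i)) p"
  by (induction p rule: mvpoly_induct)
     (simp_all add: subst_poly_single monomial_at_def subst_poly_prod subst_poly_power)

lemma subst_poly_cong:
  assumes "p \<in> mvpoly_ring k" "\<And>i. i < k \<Longrightarrow> \<sigma> i = \<tau> i"
  shows "subst_poly \<sigma> p = subst_poly \<tau> p"
proof -
  have "i < k" if "m \<in> Poly_Mapping.keys p" "i \<in> Poly_Mapping.keys m" for m i
    using assms(1) that unfolding mvpoly_ring_def by blast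
  then show ?thesis
    unfolding subst_poly_def by (intro sum.cong arg_cong2[where f = "(*)"] prod.cong refl) (simp add: assms(2))
qed

lemma var_poly_power: "var_poly i ^ n = Poly_Mapping.single (Poly_Mapping.single i n) 1"
  by (induction n) (simp_all add: var_poly_def mult_single flip: single_add)

lemma monomial_at_var: "monomial_at var_poly m = Poly_Mapping.single m (1::'f::field)"
proof -
  have "(\<Prod>i\<in>I. var_poly i ^ Poly_Mapping.lookup m i) =
      Poly_Mapping.single (\<Sum>i\<in>I. Poly_Mapping.single i (Poly_Mapping.lookup m i)) (1::'f)" if "finite I" for I
    using that by (induction I rule: finite_induct) (simp_all add: var_poly_power mult_single)
  from this[of "Poly_Mapping.keys m"] have "monomial_at var_poly m = Poly_Mapping.single
      (\<Sum>i\<in>Poly_Mapping.keys m. Poly_Mapping.single i (Poly_Mapping.lookup m i)) (1::'f)"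
    by (simp add: monomial_at_def)
  also have "(\<Sum>i\<in>Poly_Mapping.keys m. Poly_Mapping.single i (Poly_Mapping.lookup m i)) = m"
    by (rule poly_mapping_eqI) (simp add: lookup_sum lookup_single when_def in_keys_iff)
  finally show ?thesis .
qed

lemma subst_poly_id: "subst_poly var_poly p = p"
  by (induction p rule: mvpoly_induct)
     (simp_all add: subst_poly_single monomial_at_var const_poly_def mult_single)

section \<open>Polynomials in a given set of variables\<close>

definition polys_in_vars :: "nat set \<Rightarrow> 'f::field mvpoly set" where
  "polys_in_vars V = {p. \<forall>m\<in>Poly_Mapping.keys p. Poly_Mapping.keys m \<subseteq> V}"

lemma mvpoly_ring_eq: "mvpoly_ring k = polys_in_vars {..<k}"
  by (simp add: mvpoly_ring_def polys_in_vars_def)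

lemma polys_in_vars_0 [simp]: "0 \<in> polys_in_vars V"
  by (simp add: polys_in_vars_def)

lemma polys_in_vars_const [simp]: "const_poly c \<in> polys_in_vars V"
  by (simp add: polys_in_vars_def const_poly_def)

lemma polys_in_vars_1 [simp]: "1 \<in> polys_in_vars V"
  using polys_in_vars_const[of 1 V] by simp

lemma polys_in_vars_var: "i \<in> V \<Longrightarrow> var_poly i \<in> polys_in_vars V"
  by (simp add: polys_in_vars_def var_poly_def)

lemma polys_in_vars_uminus: "p \<in> polys_in_vars V \<Longrightarrow> - p \<in> polys_in_vars V"
  by (simp add: polys_in_vars_def in_keys_iff)

lemma polys_in_vars_add: "p \<in> polys_in_vars V \<Longrightarrow> q \<in> polys_in_vars V \<Longrightarrow> p + q \<in> polys_in_vars V"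
  using Poly_Mapping.keys_add[of p q] unfolding polys_in_vars_def by blast

lemma polys_in_vars_diff: "p \<in> polys_in_vars V \<Longrightarrow> q \<in> polys_in_vars V \<Longrightarrow> p - q \<in> polys_in_vars V"
  using polys_in_vars_add[OF _ polys_in_vars_uminus, of p V q] by simp

lemma polys_in_vars_mult: "p \<in> polys_in_vars V \<Longrightarrow> q \<in> polys_in_vars V \<Longrightarrow> p * q \<in> polys_in_vars V"
  unfolding polys_in_vars_def
  by (fastforce dest!: subsetD[OF Poly_Mapping.keys_mult[of p q]] subsetD[OF Poly_Mapping.keys_add])

lemma polys_in_vars_power: "p \<in> polys_in_vars V \<Longrightarrow> p ^ n \<in> polys_in_vars V"
  by (induction n) (simp_all add: polys_in_vars_mult)

lemma polys_in_vars_sum: "(\<And>i. i \<in> I \<Longrightarrow> g i \<in> polys_in_vars V) \<Longrightarrow> sum g I \<in> polys_in_vars V"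
  by (induction I rule: infinite_finite_induct) (simp_all add: polys_in_vars_add)

lemma polys_in_vars_prod: "(\<And>i. i \<in> I \<Longrightarrow> g i \<in> polys_in_vars V) \<Longrightarrow> prod g I \<in> polys_in_vars V"
  by (induction I rule: infinite_finite_induct) (simp_all add: polys_in_vars_mult)

lemma subst_poly_in_vars:
  assumes "p \<in> polys_in_vars U" "\<And>i. i \<in> U \<Longrightarrow> \<sigma> i \<in> polys_in_vars V"
  shows "subst_poly \<sigma> p \<in> polys_in_vars V"
  unfolding subst_poly_def using assms polys_in_vars_def[of U]
  by (intro polys_in_vars_sum polys_in_vars_mult polys_in_vars_prod polys_in_vars_power) auto

text \<open>All monomials of c n * var_poly i ^ n have exponent n at the variable i, so no two summands have a
  monomial in common.\<close>
lemma var_poly_powers_independent: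
  assumes "\<And>n. c n \<in> polys_in_vars (- {i})" "(\<Sum>n\<le>N. c n * var_poly i ^ n) = 0" "n \<le> N"
  shows "c n = (0 :: 'f::field mvpoly)"
proof -
  have key: "Poly_Mapping.lookup m i = n" if m: "m \<in> Poly_Mapping.keys (c n * var_poly i ^ n)" for m n
  proof -
    obtain a where "m = a + Poly_Mapping.single i n" "a \<in> Poly_Mapping.keys (c n)"
      using m subsetD[OF Poly_Mapping.keys_mult[of "c n" "var_poly i ^ n"]] by (auto simp: var_poly_power)
    then show ?thesis using assms(1)[of n] by (auto simp: polys_in_vars_def lookup_add in_keys_iff)
  qed
  have "c n * var_poly i ^ n = 0"
  proof (rule poly_mapping_eqI)
    fix m
    show "Poly_Mapping.lookup (c n * var_poly i ^ n) m = Poly_Mapping.lookup 0 m"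
    proof (cases "Poly_Mapping.lookup m i = n")
      case True
      have "0 = Poly_Mapping.lookup (\<Sum>j\<le>N. c j * var_poly i ^ j) m" using assms(2) by simp
      also have "\<dots> = (\<Sum>j\<le>N. Poly_Mapping.lookup (c j * var_poly i ^ j) m)" by (rule lookup_sum)
      also have "\<dots> = (\<Sum>j\<in>{n}. Poly_Mapping.lookup (c j * var_poly i ^ j) m)"
        using True key assms(3) by (intro sum.mono_neutral_right) (auto simp: in_keys_iff)
      finally show ?thesis by simp
    next
      case False
      then show ?thesis using key[of m n] by (auto simp: in_keys_iff)
    qed
  qed
  moreover have "var_poly i ^ n \<noteq> (0 :: 'f mvpoly)"
    unfolding var_poly_power by (metis lookup_single_eq lookup_zero zero_neq_one)
  ultimately show ?thesis by (metis mult_eq_0_iff)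
qed

section \<open>Algebraic independence of the variables\<close>

abbreviation constants :: "'f::field mvpoly fract set" where
  "constants \<equiv> range (\<lambda>c. to_fract (const_poly c))"

lemma constants_subfield: "is_subfield (constants :: 'f::field mvpoly fract set)"
proof -
  have minus: "const_poly (- c) = - const_poly (c::'f)" for c
    by (simp add: const_poly_def single_uminus)
  have "inverse (to_fract (const_poly c)) = to_fract (const_poly (inverse c))" for c :: 'f
  proof (cases "c = 0")
    case False
    then have "const_poly c * const_poly (inverse c) = 1" by (simp flip: const_poly_simps)
    then have "to_fract (const_poly c) * to_fract (const_poly (inverse c)) = 1"
      by (simp flip: to_fract_mult)
    then show ?thesis by (rule inverse_unique)
  qed simp
  moreover have "1 \<in> (constants :: 'f mvpoly fract set)"
    by (intro image_eqI[of _ _ 1]) simp_all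
  moreover have "- to_fract (const_poly c) = to_fract (const_poly (- c))" for c :: 'f
    by (simp add: minus)
  moreover have "to_fract (const_poly c) + to_fract (const_poly d) = to_fract (const_poly (c + d))"
    "to_fract (const_poly c) * to_fract (const_poly d) = to_fract (const_poly (c * d))" for c d :: 'f
    by simp_all
  ultimately show ?thesis
    unfolding is_subfield_iff is_subring_iff by (auto simp only: image_iff UNIV_I ball_simps bex_simps)
qed

lemma to_fract_polys_in_vars_subring: "is_subring (to_fract ` (polys_in_vars V :: 'f::field mvpoly set))"
  unfolding is_subring_iff
proof (intro conjI ballI)
  show "1 \<in> to_fract ` (polys_in_vars V :: 'f mvpoly set)" by (intro image_eqI[of _ _ 1]) simp_all
qed (auto simp: polys_in_vars_uminus polys_in_vars_add polys_in_vars_mult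
       simp flip: to_fract_add to_fract_mult to_fract_uminus)

text \<open>The field generated by the variables in V consists of quotients of polynomials that do not involve
  the variable i; so an algebraic equation over it gives, after clearing denominators, a relation
  between powers of the variable i with such polynomials as coefficients.\<close>
theorem variables_algebraically_independent:
  fixes i :: nat
  assumes "i \<notin> V"
  shows "to_fract (var_poly i) \<notin> algebraic_span constants (to_fract ` var_poly ` V :: 'f::field mvpoly fract set)"
proof
  let ?x = "to_fract (var_poly i) :: 'f mvpoly fract"
  let ?R = "generate_ring ring_of_type_algebra (constants \<union> to_fract ` var_poly ` V) :: 'f mvpoly fract set"
  assume "?x \<in> algebraic_span constants (to_fract ` var_poly ` V)"
  then have "algebraic_over ?R ?x"
    unfolding algebraic_span_def generate_field_eq_quots
    using algebraic_over_quots[OF generate_ring_subring] by blast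
  moreover have "?R \<subseteq> to_fract ` polys_in_vars (- {i})"
    using assms
    by (intro generate_ring_least to_fract_polys_in_vars_subring) (auto intro!: imageI polys_in_vars_var)
  ultimately have "algebraic_over (to_fract ` polys_in_vars (- {i})) ?x"
    using algebraic_over_mono by blast
  then obtain p where p: "\<And>n. coeff p n \<in> to_fract ` polys_in_vars (- {i})" "p \<noteq> 0" "poly p ?x = 0"
    unfolding algebraic_over_def polys_over_def by auto
  have "\<exists>q. q \<in> polys_in_vars (- {i}) \<and> coeff p n = to_fract q" for n using p(1)[of n] by blast
  then obtain c where c: "\<And>n. c n \<in> polys_in_vars (- {i})" "\<And>n. coeff p n = to_fract (c n)" by metis
  have to_fract_power: "to_fract (q ^ n) = to_fract q ^ n" for q :: "'f mvpoly" and n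
    by (induction n) simp_all
  have to_fract_sum: "to_fract (\<Sum>n\<in>I. g n) = (\<Sum>n\<in>I. to_fract (g n))"
    for I :: "nat set" and g :: "nat \<Rightarrow> 'f mvpoly"
    by (induction I rule: infinite_finite_induct) simp_all
  have "to_fract (\<Sum>n\<le>degree p. c n * var_poly i ^ n) = poly p ?x"
    by (simp add: poly_altdef c(2) to_fract_power to_fract_sum)
  then have "(\<Sum>n\<le>degree p. c n * var_poly i ^ n) = 0" by (simp only: p(3) to_fract_eq_0_iff)
  then have "c (degree p) = 0" using var_poly_powers_independent[of c i "degree p"] c(1) by blast
  then show False using p(2) c(2)[of "degree p"] by simp
qed

section \<open>The action on polynomial functions\<close>

context faithful_representation
begin

abbreviation act :: "'h \<Rightarrow> 'f mvpoly \<Rightarrow> 'f mvpoly" where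
  "act \<equiv> poly_action scale k b H \<rho>"

abbreviation coordinate :: "nat \<Rightarrow> 'v \<Rightarrow> 'f" where
  "coordinate j v \<equiv> representation (b ` {..<k}) v (b j)"

sublocale H: group H
  using group_hom group_hom.axioms(1) by blast

lemma sum_coordinates: "(\<Sum>i<k. scale (coordinate i v) (b i)) = v"
proof -
  have "(\<Sum>w\<in>b ` {..<k}. scale (representation (b ` {..<k}) v w) w) = v"
    using basis_independent basis_span by (intro sum_representation_eq) auto
  then show ?thesis using basis_inj by (simp add: sum.reindex)
qed

lemma coordinate_basis: "i < k \<Longrightarrow> j < k \<Longrightarrow> coordinate j (b i) = (if i = j then 1 else 0)"
  using basis_independent basis_inj by (auto simp: representation_basis inj_on_def)

text \<open>The matrix of a linear map with respect to the basis b computes the coordinates of its values.\<close>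
lemma coordinate_linear:
  assumes "Vector_Spaces.linear scale scale T"
  shows "coordinate j (T v) = (\<Sum>i<k. coordinate i v * coordinate j (T (b i)))"
proof -
  interpret T: Vector_Spaces.linear scale scale T by fact
  have "T v = (\<Sum>i<k. scale (coordinate i v) (T (b i)))"
    by (subst sum_coordinates[of v, symmetric]) (simp add: T.sum T.scale)
  then show ?thesis
    using basis_independent basis_span by (simp add: representation_sum representation_scale)
qed

text \<open>Pulling back functions reverses composition; the underlying identity is the product of matrices.\<close>
lemma coord_pullback_comp:
  assumes "Vector_Spaces.linear scale scale T"
  shows "subst_poly (coord_pullback scale k b S) (coord_pullback scale k b T j) =
    coord_pullback scale k b (\<lambda>v. T (S v)) j"
proof -
  have "coord_pullback scale k b (\<lambda>v. T (S v)) j =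
      (\<Sum>l<k. \<Sum>i<k. const_poly (coordinate i (S (b l))) * const_poly (coordinate j (T (b i))) * var_poly l)"
    unfolding coord_pullback_def
    by (subst coordinate_linear[OF assms]) (simp add: const_poly_sum sum_distrib_right)
  also have "\<dots> = (\<Sum>i<k. \<Sum>l<k. const_poly (coordinate i (S (b l))) * const_poly (coordinate j (T (b i))) * var_poly l)"
    by (rule sum.swap)
  also have "\<dots> = subst_poly (coord_pullback scale k b S) (coord_pullback scale k b T j)"
    unfolding coord_pullback_def by (simp add: subst_poly_sum sum_distrib_left mult_ac)
  finally show ?thesis by simp
qed

lemma coord_pullback_id: "j < k \<Longrightarrow> coord_pullback scale k b (\<lambda>v. v) j = var_poly j"
  unfolding coord_pullback_def
  by (simp add: coordinate_basis if_distrib[of const_poly] if_distrib[of "\<lambda>c. c * _"] cong: if_cong)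

lemma coord_pullback_in_ring: "coord_pullback scale k b T j \<in> mvpoly_ring k"
  unfolding coord_pullback_def mvpoly_ring_eq
  by (intro polys_in_vars_sum polys_in_vars_mult polys_in_vars_const polys_in_vars_var) simp

lemma act_in_ring: "p \<in> mvpoly_ring k \<Longrightarrow> act h p \<in> mvpoly_ring k"
  unfolding poly_action_def using coord_pullback_in_ring
  by (auto simp: mvpoly_ring_eq intro: subst_poly_in_vars)

lemma act_one: "p \<in> mvpoly_ring k \<Longrightarrow> act \<one> p = p"
proof -
  assume p: "p \<in> mvpoly_ring k"
  have "\<rho> \<one> = (\<lambda>v. v)" using id_eq_one by (simp add: fun_eq_iff restrict_def)
  then have "act \<one> p = subst_poly var_poly p"
    unfolding poly_action_def using coord_pullback_id by (intro subst_poly_cong[OF p]) simp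
  then show ?thesis by (simp add: subst_poly_id)
qed

text \<open>The inverse in the definition of the action cancels the order reversal of
  \<open>coord_pullback_comp\<close>, so this is a left action.\<close>
lemma act_mult:
  assumes g: "g \<in> carrier H" and h: "h \<in> carrier H"
  shows "act (g \<otimes> h) p = act g (act h p)"
proof -
  have "\<rho> (inv (g \<otimes> h)) = (\<lambda>v. \<rho> (inv h) (\<rho> (inv g) v))"
    using g h composition_rule[of _ "inv h" "inv g"] by (simp add: fun_eq_iff H.inv_mult_group)
  then show ?thesis
    unfolding poly_action_def
    using coord_pullback_comp[OF linear_action[OF H.inv_closed[OF h]], of "\<rho> (inv g)"]
    by (simp add: subst_poly_subst_poly)
qed

lemma act_hom:
  "act h 0 = 0" "act h 1 = 1" "act h (p + q) = act h p + act h q" "act h (- p) = - act h p"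
  "act h (p * q) = act h p * act h q"
  by (simp_all add: poly_action_def)

lemma act_eq_0_iff: "h \<in> carrier H \<Longrightarrow> p \<in> mvpoly_ring k \<Longrightarrow> act h p = 0 \<longleftrightarrow> p = 0"
  using act_mult[of "inv h" h p] act_one[of p] act_hom(1) by (metis H.inv_closed H.l_inv)

lemma map_poly_act_mult: "map_poly (act h) (p * q) = map_poly (act h) p * map_poly (act h) q"
proof (rule poly_eqI)
  have "act h (sum g I) = (\<Sum>i\<in>I. act h (g i))" for g and I :: "nat set"
    by (simp add: poly_action_def subst_poly_sum)
  then show "coeff (map_poly (act h) (p * q)) n = coeff (map_poly (act h) p * map_poly (act h) q) n" for n
    by (simp add: coeff_map_poly act_hom coeff_mult)
qed

lemma finite_subgroup: "subgroup G H \<Longrightarrow> finite G"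
  using finite_group by (meson finite_subset subgroup.subset)

definition orbit_poly :: "'h set \<Rightarrow> 'f mvpoly \<Rightarrow> 'f mvpoly poly" where
  "orbit_poly G p = (\<Prod>g\<in>G. [:- act g p, 1:])"

text \<open>An element h of G permutes the factors of the orbit polynomial, so it fixes the coefficients.\<close>
lemma orbit_poly_coeff:
  assumes G: "subgroup G H" and p: "p \<in> mvpoly_ring k"
  shows "coeff (orbit_poly G p) n \<in> poly_invariants scale k b H \<rho> G"
proof -
  have "\<forall>n. coeff (\<Prod>g\<in>A. [:- act g p, 1:]) n \<in> mvpoly_ring k" if "finite A" for A
    using that
  proof (induction A rule: finite_induct)
    case empty
    then show ?case by (simp add: mvpoly_ring_eq)
  next
    case (insert g A)
    show ?case
      using insert.IH act_in_ring[OF p, of g] insert.hyps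
      by (auto simp: mvpoly_ring_eq coeff_pCons polys_in_vars_diff polys_in_vars_uminus
          polys_in_vars_mult split: nat.split)
  qed
  then have ring: "coeff (orbit_poly G p) n \<in> mvpoly_ring k"
    using finite_subgroup[OF G] by (simp add: orbit_poly_def)
  have "act h (coeff (orbit_poly G p) n) = coeff (orbit_poly G p) n" if h: "h \<in> G" for h
  proof -
    have hH: "h \<in> carrier H" using subgroup.mem_carrier[OF G h] .
    have "map_poly (act h) (\<Prod>g\<in>A. [:- act g p, 1:]) = (\<Prod>g\<in>A. [:- act (h \<otimes> g) p, 1:])"
      if "finite A" "A \<subseteq> G" for A
      using that
    proof (induction A rule: finite_induct)
      case empty
      then show ?case by (simp add: act_hom)
    next
      case (insert g A)
      then have "g \<in> carrier H" using subgroup.mem_carrier[OF G] by blast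
      then show ?case
        using insert hH by (simp add: map_poly_act_mult map_poly_pCons act_hom act_mult del: mult_pCons_left)
    qed
    then have "map_poly (act h) (orbit_poly G p) = (\<Prod>g\<in>G. [:- act (h \<otimes> g) p, 1:])"
      unfolding orbit_poly_def using finite_subgroup[OF G] by blast
    also have "\<dots> = orbit_poly G p"
      unfolding orbit_poly_def
    proof (rule prod.reindex_bij_witness[of _ "\<lambda>g. inv h \<otimes> g" "\<lambda>g. h \<otimes> g"])
      fix g assume g: "g \<in> G"
      then have gH: "g \<in> carrier H" using subgroup.mem_carrier[OF G] by blast
      show "inv h \<otimes> (h \<otimes> g) = g" "h \<otimes> (inv h \<otimes> g) = g"
        using hH gH by (simp_all flip: H.m_assoc)
      show "h \<otimes> g \<in> G" "inv h \<otimes> g \<in> G"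
        using G g h by (simp_all add: subgroup.m_closed subgroup.m_inv_closed)
    qed simp
    finally show ?thesis by (metis act_hom(1) coeff_map_poly)
  qed
  then show ?thesis using ring by (simp add: poly_invariants_def)
qed

text \<open>The polynomial p is a root of its orbit polynomial, as the factor at the neutral element vanishes
  there.\<close>
theorem integral_over_invariants:
  assumes G: "subgroup G H" and p: "p \<in> mvpoly_ring k"
  obtains q where "q \<in> polys_over (to_fract ` poly_invariants scale k b H \<rho> G)"
    "lead_coeff q = 1" "poly q (to_fract p) = 0"
proof
  let ?q = "fract_poly (orbit_poly G p)"
  show "?q \<in> polys_over (to_fract ` poly_invariants scale k b H \<rho> G)"
    using orbit_poly_coeff[OF G p] by (simp add: polys_over_def coeff_map_poly)
  have "lead_coeff (orbit_poly G p) = 1"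
    unfolding orbit_poly_def by (simp add: lead_coeff_prod)
  then show "lead_coeff ?q = 1" by (simp add: degree_map_poly coeff_map_poly)
  have "poly (fract_poly r) (to_fract p) = to_fract (poly r p)" for r
    by (induction r) (simp_all add: map_poly_pCons)
  moreover have "poly (orbit_poly G p) p = 0"
    unfolding orbit_poly_def poly_prod using finite_subgroup[OF G] subgroup.one_closed[OF G] act_one[OF p]
    by (intro prod_zero bexI[of _ \<one>]) simp_all
  ultimately show "poly ?q (to_fract p) = 0" by simp
qed

text \<open>The point is that the induced action on fractions is well defined at p / 1: if p / 1 = p' / q', then
  p' = p * q', and the action is multiplicative and keeps q' nonzero.\<close>
lemma poly_invariants_subset_rat_invariants:
  assumes G: "G \<subseteq> carrier H"
  shows "to_fract ` poly_invariants scale k b H \<rho> G \<subseteq> rat_invariants scale k b H \<rho> G"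
proof
  fix r assume "r \<in> to_fract ` poly_invariants scale k b H \<rho> G"
  then obtain p where r: "r = Fraction_Field.Fract p 1" and p: "p \<in> mvpoly_ring k"
    and inv: "\<And>g. g \<in> G \<Longrightarrow> act g p = p"
    by (auto simp: poly_invariants_def to_fract_def)
  have one: "1 \<in> mvpoly_ring k" by (simp add: mvpoly_ring_eq)
  have "r \<in> rat_field k"
    unfolding rat_field_def r using p one by (intro CollectI exI[of _ p] exI[of _ 1]) simp
  moreover have "rat_action scale k b H \<rho> g r = r" if g: "g \<in> G" for g
    unfolding rat_action_def
  proof (rule the_equality)
    show "\<exists>p\<in>mvpoly_ring k. \<exists>q\<in>mvpoly_ring k. q \<noteq> 0 \<and> r = Fraction_Field.Fract p q \<and>
        r = Fraction_Field.Fract (act g p) (act g q)"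
      using p one inv[OF g] r by (intro bexI[of _ p] bexI[of _ 1]) (simp_all add: act_hom)
    fix s assume "\<exists>p\<in>mvpoly_ring k. \<exists>q\<in>mvpoly_ring k. q \<noteq> 0 \<and> r = Fraction_Field.Fract p q \<and>
        s = Fraction_Field.Fract (act g p) (act g q)"
    then obtain p' q' where q': "q' \<in> mvpoly_ring k" "q' \<noteq> 0" "r = Fraction_Field.Fract p' q'"
      "s = Fraction_Field.Fract (act g p') (act g q')" by blast
    have "p' = p * q'" using q'(2,3) r by (simp add: eq_fract)
    moreover have "act g q' \<noteq> 0" using act_eq_0_iff q'(1,2) g G by blast
    ultimately show "s = r" using q'(4) r inv[OF g] by (simp add: act_hom eq_fract)
  qed
  ultimately show "r \<in> rat_invariants scale k b H \<rho> G" by (simp add: rat_invariants_def)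
qed

end

section \<open>Normality of the algebra generated by the rational invariants\<close>

text \<open>An algebra on algebraically independent generators is a polynomial ring over the field C, and it
  arises from C by adjoining one transcendental element after the other.\<close>
lemma completely_integrally_closed_independent:
  fixes fs :: "nat \<Rightarrow> 'a::field"
  assumes C: "is_subfield C" and indep: "\<And>i. i < k \<Longrightarrow> fs i \<notin> algebraic_span C (fs ` {..<i})"
  shows "completely_integrally_closed (generate_ring ring_of_type_algebra (C \<union> fs ` {..<k}))"
  using indep
proof (induction k)
  case 0
  have "generate_ring ring_of_type_algebra (C \<union> fs ` {..<0}) = C"
    using generate_ring_least[OF subfieldE(1)[OF C], of C] by (auto intro: generate_ring.incl)
  then show ?case using completely_integrally_closed_subfield[OF C] by simp
next
  case (Suc n)
  let ?R = "generate_ring ring_of_type_algebra (C \<union> fs ` {..<n})"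
  have R: "is_subring ?R" by (rule generate_ring_subring)
  have "p = 0" if "p \<in> polys_over ?R" "poly p (fs n) = 0" for p
  proof (rule ccontr)
    assume "p \<noteq> 0"
    then have "algebraic_over (quots ?R) (fs n)"
      using that polys_over_mono[OF subset_quots[OF R]] unfolding algebraic_over_def by blast
    then show False
      using Suc.prems[of n] unfolding algebraic_span_def generate_field_eq_quots by simp
  qed
  then have "completely_integrally_closed (adjoin ?R (fs n))"
    using Suc by (intro completely_integrally_closed_adjoin[OF R]) auto
  then show ?case by (simp add: lessThan_Suc generate_ring_insert)
qed

lemma inj_var_poly: "inj (\<lambda>i. to_fract (var_poly i :: 'f::field mvpoly))"
proof (rule injI)
  fix i j assume "to_fract (var_poly i :: 'f mvpoly) = to_fract (var_poly j)"
  then have "Poly_Mapping.keys (var_poly i :: 'f mvpoly) = Poly_Mapping.keys (var_poly j :: 'f mvpoly)" by simp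
  then have "Poly_Mapping.single i (1::nat) = Poly_Mapping.single j 1" by (simp add: var_poly_def)
  then have "Poly_Mapping.keys (Poly_Mapping.single i (1::nat)) = Poly_Mapping.keys (Poly_Mapping.single j (1::nat))" by simp
  then show "i = j" by simp
qed

theorem proposition3p1:
  fixes scale :: "'f::field \<Rightarrow> 'v::ab_group_add \<Rightarrow> 'v"
    and k :: nat and b :: "nat \<Rightarrow> 'v"
    and H :: "('h, 'm) monoid_scheme" and \<rho> :: "'h \<Rightarrow> 'v \<Rightarrow> 'v"
    and G :: "'h set"
    and fs :: "nat \<Rightarrow> 'f mvpoly fract" and f :: "'f mvpoly"
  defines "FVG \<equiv> to_fract ` poly_invariants scale k b H \<rho> G"
    and "FVH \<equiv> to_fract ` poly_invariants scale k b H \<rho> (carrier H)"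
    and "B \<equiv> gen_algebra (fs ` {..<k})"
  assumes rep: "faithful_representation scale k b H \<rho>"
    and subgroup: "subgroup G H"
    and fs_invariant: "\<And>i. i < k \<Longrightarrow> fs i \<in> rat_invariants scale k b H \<rho> G"
    and fs_generate: "rat_invariants scale k b H \<rho> G = gen_field (fs ` {..<k})"
    and f_nonzero: "f \<noteq> 0"
    and f_homogeneous: "homogeneous_poly f"
    and f_mem: "to_fract f \<in> B \<inter> FVG"
    and localization_subset:
      "adjoin_inverse B (to_fract f) \<subseteq> adjoin_inverse FVG (to_fract f)"
  shows "(integral_over (adjoin_inverse B (to_fract f)) (adjoin_inverse FVG (to_fract f)) \<longrightarrow>
            adjoin_inverse FVG (to_fract f) = adjoin_inverse B (to_fract f)) \<and>
         (FVH \<subseteq> adjoin_inverse B (to_fract f) \<longrightarrow>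
            adjoin_inverse FVG (to_fract f) = adjoin_inverse B (to_fract f))"
proof -
  interpret faithful_representation scale k b H \<rho> by (rule rep)
  interpret cl: exchange_closure "algebraic_span (constants :: 'f mvpoly fract set)"
    by (rule exchange_closure_algebraic_span)
  let ?f = "to_fract f"
  have B_eq: "B = generate_ring ring_of_type_algebra (constants \<union> fs ` {..<k})"
    by (simp add: B_def gen_algebra_def)
  have B: "is_subring B" unfolding B_eq by (rule generate_ring_subring)
  have quots_B: "quots B = generate_field ring_of_type_algebra (constants \<union> fs ` {..<k})"
    unfolding B_eq by (rule generate_field_eq_quots[symmetric])
  have "G \<subseteq> carrier H" using subgroup by (rule subgroup.subset)
  then have "FVG \<subseteq> rat_invariants scale k b H \<rho> G"
    unfolding FVG_def by (rule poly_invariants_subset_rat_invariants)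
  then have FVG: "FVG \<subseteq> quots B"
    unfolding fs_generate gen_field_def quots_B .
  have f: "?f \<in> B" "?f \<noteq> 0" using f_mem f_nonzero by auto

  \<comment> \<open>The k variables are independent and algebraic over F(V)^G, which is generated by the k elements fs i.\<close>
  define vars where "vars = (\<lambda>i. to_fract (var_poly i) :: 'f mvpoly fract) ` {..<k}"
  have vars: "finite vars" "card vars = k"
    unfolding vars_def by (simp_all add: card_image[OF inj_on_subset[OF inj_var_poly subset_UNIV]])
  have vars_indep: "x \<notin> algebraic_span constants (vars - {x})" if x: "x \<in> vars" for x
  proof -
    obtain i where i: "x = to_fract (var_poly i)" using x by (auto simp: vars_def)
    have "vars - {x} = to_fract ` var_poly ` ({..<k} - {i})"
      unfolding vars_def i image_image by (subst image_set_diff[OF inj_var_poly]) simp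
    then show ?thesis using variables_algebraically_independent[of i "{..<k} - {i}"] i by simp
  qed
  have "vars \<subseteq> algebraic_span constants (fs ` {..<k})"
  proof
    fix x assume "x \<in> vars"
    then obtain i where i: "i < k" "x = to_fract (var_poly i)" by (auto simp: vars_def)
    have "var_poly i \<in> mvpoly_ring k" using i by (simp add: mvpoly_ring_eq polys_in_vars_var)
    then obtain q where "q \<in> polys_over FVG" "lead_coeff q = 1" "poly q x = 0"
      unfolding FVG_def i by (rule integral_over_invariants[OF subgroup])
    then have "algebraic_over (quots B) x"
      using polys_over_mono[OF FVG] unfolding algebraic_over_def by (intro bexI[of _ q]) auto
    then show "x \<in> algebraic_span constants (fs ` {..<k})"
      unfolding quots_B algebraic_span_def by simp
  qed
  then have "fs i \<notin> algebraic_span constants (fs ` ({..<k} - {i}))" if "i < k" for i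
    using cl.spanning_family_independent[OF vars(1) vars_indep, of fs i] that vars(2) by simp
  moreover have "algebraic_span constants (fs ` {..<i}) \<subseteq> algebraic_span constants (fs ` ({..<k} - {i}))"
    if "i < k" for i using that by (intro cl.mono) auto
  ultimately have "completely_integrally_closed B"
    unfolding B_eq by (intro completely_integrally_closed_independent constants_subfield) blast
  note normal = integral_in_localisation[OF B this f]

  let ?Bf = "adjoin_inverse B ?f" and ?Af = "adjoin_inverse FVG ?f"
  have Bf: "is_subring ?Bf" unfolding adjoin_inverse_def by (rule generate_ring_subring)
  \<comment> \<open>Both parts amount to showing that each polynomial invariant of G is integral over B[1/f].\<close>
  have eq: "?Af = ?Bf" if "FVG \<subseteq> ?Bf"
  proof
    have "inverse ?f \<in> ?Bf" unfolding adjoin_inverse_def by (auto intro: generate_ring.incl)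
    then show "?Af \<subseteq> ?Bf"
      using that unfolding adjoin_inverse_def[of FVG] by (intro generate_ring_least[OF Bf]) simp
  qed (rule localization_subset)
  show ?thesis
  proof (intro conjI impI)
    assume int: "integral_over ?Bf ?Af"
    have "FVG \<subseteq> ?Af" unfolding adjoin_inverse_def by (auto intro: generate_ring.incl)
    then have "a \<in> ?Bf" if "a \<in> FVG" for a
      using that int normal[of a] FVG unfolding integral_over_def polys_over_def by blast
    then show "?Af = ?Bf" by (intro eq) blast
  next
    assume FVH: "FVH \<subseteq> ?Bf"
    have "a \<in> ?Bf" if a: "a \<in> FVG" for a
    proof -
      obtain p where p: "a = to_fract p" "p \<in> mvpoly_ring k"
        using a by (auto simp: FVG_def poly_invariants_def)
      obtain q where "q \<in> polys_over FVH" "lead_coeff q = 1" "poly q a = 0"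
        using integral_over_invariants[OF H.subgroup_self p(2)] unfolding FVH_def p(1) by blast
      then show ?thesis using normal[of a q] polys_over_mono[OF FVH] FVG a by blast
    qed
    then show "?Af = ?Bf" by (intro eq) blast
  qed
qed

end
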